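(* (a) For every $s=2,\ldots,d+1$ there exists a set $F$ with $|F|=s$ consisting of unipotent automorphisms of $\mathbb{T}^d$ such that $F$ is not mixing, but every proper subset of $F$ is mixing. (b) For every $s=2,\ldots,d+1$ there exists a set $F$ of mixing epimorphisms of $\mathbb{T}^d$ with $|F|=s$ such that $F$ is not mixing, but every proper subset of $F$ is mixing.
   Context: $\mathbb{T}^d=\mathbb{R}^d/\mathbb{Z}^d$ is the $d$-dimensional torus with normalized Haar measure $m$; $\mathcal{B}$ is the completion of its Borel $\sigma$-algebra. An epimorphism is a continuous surjective homomorphism of $\mathbb{T}^d$ to itself; a single epimorphism $T$ is mixing if $m(A\cap T^{-n}B)\to m(A)m(B)$ as $n\to\infty$ for all $A,B\in\mathcal{B}$. A finite set $F$, $|F|>1$, of epimorphisms is called mixing if for every collection $B_\gamma\in\mathcal{B}$, $\gamma\in F$, one has $m\left(\bigcap_{\gamma\in F}\gamma^{-n}(B_\gamma)\right)\to\prod_{\gamma\in F}m(B_\gamma)$ as $n\to\infty$. An automorphism $T$ of $\mathbb{T}^d$ is unipotent if the matrix $\hat T$ of the induced map $\chi\mapsto\chi\circ T$ on the character group $\mathbb{Z}^d$ is unipotent.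
   Formalization: Part (a) is stated for d ≥ 2 only, since for d = 1 the identity is the only unipotent automorphism of the circle, so no set of s = 2 unipotent automorphisms exists. *)

theory Defs
  imports "HOL-Analysis.Analysis"
begin

section \<open>The torus\<close>

definition int_cong :: "real ^ 'n \<Rightarrow> real ^ 'n \<Rightarrow> bool" where
  "int_cong x y \<longleftrightarrow> (\<forall>i. x $ i - y $ i \<in> \<int>)"

lemma equivp_int_cong: "equivp int_cong"
proof (rule equivpI)
  show "reflp int_cong" by (simp add: reflp_def int_cong_def)
  show "symp int_cong"
    unfolding symp_def int_cong_def by (metis Ints_minus minus_diff_eq)
  show "transp int_cong"
  proof (rule transpI)
    fix x y z :: "real ^ 'n"
    assume "int_cong x y" "int_cong y z"
    then have "(x $ i - y $ i) + (y $ i - z $ i) \<in> \<int>" for i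
      unfolding int_cong_def by (intro Ints_add) auto
    then show "int_cong x z" by (simp add: int_cong_def)
  qed
qed

quotient_type 'n torus = "real ^ 'n" / "int_cong :: real ^ 'n::finite \<Rightarrow> _"
  morphisms rep_torus torus_proj
  by (rule equivp_int_cong)

instantiation torus :: (finite) ab_group_add
begin

lift_definition zero_torus :: "'a torus" is 0 .

lift_definition plus_torus :: "'a torus \<Rightarrow> 'a torus \<Rightarrow> 'a torus" is "(+)"
proof -
  fix x x' y y' :: "real ^ 'a"
  assume "int_cong x x'" "int_cong y y'"
  then have "(x $ i - x' $ i) + (y $ i - y' $ i) \<in> \<int>" for i
    unfolding int_cong_def by (intro Ints_add) auto
  then show "int_cong (x + y) (x' + y')" by (simp add: int_cong_def algebra_simps)
qed

lift_definition uminus_torus :: "'a torus \<Rightarrow> 'a torus" is uminus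
proof -
  fix x x' :: "real ^ 'a"
  assume "int_cong x x'"
  then have "- (x $ i - x' $ i) \<in> \<int>" for i
    unfolding int_cong_def by (intro Ints_minus) auto
  then show "int_cong (- x) (- x')" by (simp add: int_cong_def)
qed

lift_definition minus_torus :: "'a torus \<Rightarrow> 'a torus \<Rightarrow> 'a torus" is "(-)"
proof -
  fix x x' y y' :: "real ^ 'a"
  assume "int_cong x x'" "int_cong y y'"
  then have "(x $ i - x' $ i) - (y $ i - y' $ i) \<in> \<int>" for i
    unfolding int_cong_def by (blast intro: Ints_diff)
  then show "int_cong (x - y) (x' - y')" by (simp add: int_cong_def algebra_simps)
qed

instance
  by standard (transfer; simp add: int_cong_def algebra_simps)+

end

text \<open>The quotient topology.\<close>

instantiation torus :: (finite) topological_space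
begin

definition open_torus :: "'a torus set \<Rightarrow> bool" where
  "open_torus U \<longleftrightarrow> open (torus_proj -` U)"

instance
  by standard (auto simp: open_torus_def vimage_Union intro: open_Int open_UN)

end

definition unit_cube :: "(real ^ 'n) set" where
  "unit_cube = {x. \<forall>i. 0 \<le> x $ i \<and> x $ i < 1}"

text \<open>Normalized Haar measure on the completed Borel sigma-algebra, obtained by pushing Lebesgue
  measure on a fundamental domain forward to the quotient.\<close>

definition torus_haar :: "'n::finite torus measure" where
  "torus_haar = completion (distr (uniform_measure lborel unit_cube) borel torus_proj)"

lemma torus_proj_eq_iff: "torus_proj x = torus_proj y \<longleftrightarrow> (\<forall>i. x $ i - y $ i \<in> \<int>)"
  by (simp add: torus.abs_eq_iff int_cong_def)

lemma torus_proj_add: "torus_proj (x + y) = torus_proj x + torus_proj y"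
  by (simp add: plus_torus.abs_eq)

lemma torus_proj_cases: obtains x where "t = torus_proj x"
  using torus.abs_induct [of "\<lambda>t. \<exists>x. t = torus_proj x" t] that by blast

lemma continuous_on_torus_proj: "continuous_on UNIV torus_proj"
  by (auto simp: continuous_on_open_vimage open_torus_def)

lemma measurable_torus_proj [measurable]: "torus_proj \<in> borel_measurable borel"
  by (rule borel_measurable_continuous_onI [OF continuous_on_torus_proj])

lemma sets_unit_cube [measurable]: "(unit_cube :: (real ^ 'n::finite) set) \<in> sets borel"
  unfolding unit_cube_def by measurable

lemma emeasure_unit_cube: "emeasure lborel (unit_cube :: (real ^ 'n::finite) set) = 1"
proof (rule antisym)
  have prod1: "prod ((\<bullet>) 1) (\<Union>i::'n. {axis i (1::real)}) = 1"
    by (rule prod.neutral) (auto simp: inner_axis)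
  have "emeasure lborel (unit_cube :: (real ^ 'n) set) \<le> emeasure lborel (cbox (0::real^'n) 1)"
    by (rule emeasure_mono) (auto simp: unit_cube_def mem_box_cart less_imp_le)
  also have "\<dots> = 1"
    using prod1 by (subst emeasure_lborel_cbox) (auto simp: Basis_vec_def inner_axis)
  finally show "emeasure lborel (unit_cube :: (real ^ 'n) set) \<le> 1" .
  have "1 = emeasure lborel (box (0::real^'n) 1)"
    using prod1 by (subst emeasure_lborel_box) (auto simp: Basis_vec_def inner_axis)
  also have "\<dots> \<le> emeasure lborel (unit_cube :: (real ^ 'n) set)"
    by (rule emeasure_mono) (auto simp: unit_cube_def mem_box_cart less_imp_le)
  finally show "1 \<le> emeasure lborel (unit_cube :: (real ^ 'n) set)" .
qed

lemma emeasure_torus_haar: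
  fixes A :: "'n::finite torus set"
  assumes "A \<in> sets borel"
  shows "emeasure torus_haar A = emeasure lborel (unit_cube \<inter> torus_proj -` A)"
proof -
  have [measurable]: "torus_proj -` A \<in> sets borel"
    using measurable_sets_borel [OF measurable_torus_proj assms] .
  show ?thesis using assms
    by (simp add: torus_haar_def emeasure_distr measurable_cong_sets [OF sets_uniform_measure refl]
        emeasure_unit_cube divide_ennreal_def)
qed

lemma space_torus_haar [simp]: "space torus_haar = UNIV"
  by (simp add: torus_haar_def)

lemma emeasure_torus_haar_UNIV: "emeasure torus_haar UNIV = 1"
  by (simp add: emeasure_torus_haar emeasure_unit_cube)

lemma emeasure_lborel_vimage_plus:
  fixes S :: "'a::euclidean_space set"
  assumes "S \<in> sets borel"
  shows "emeasure lborel ((+) c -` S) = emeasure lborel S"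
proof -
  have "emeasure lborel S = emeasure (distr lborel borel ((+) c)) S"
    by (simp add: lborel_distr_plus)
  also have "\<dots> = emeasure lborel ((+) c -` S)"
    using assms by (subst emeasure_distr) auto
  finally show ?thesis ..
qed

lemma torus_haar_translation_invariant:
  fixes A :: "'n::finite torus set"
  assumes "A \<in> sets borel"
  shows "emeasure torus_haar ((+) u -` A) = emeasure torus_haar A"
proof -
  obtain t where u: "u = torus_proj t" by (rule torus_proj_cases)
  define B where "B = torus_proj -` A"
  define l :: "int ^ 'n \<Rightarrow> real ^ 'n" where "l k = (\<chi> i. of_int (k $ i))" for k
  have B [measurable]: "B \<in> sets borel"
    unfolding B_def using measurable_sets_borel [OF measurable_torus_proj assms] .
  have per: "l k + x \<in> B \<longleftrightarrow> x \<in> B" for k x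
  proof -
    have "torus_proj (l k + x) = torus_proj x"
      by (simp add: torus_proj_eq_iff l_def)
    then show ?thesis by (simp add: B_def)
  qed
  have vB: "torus_proj -` ((+) u -` A) = (+) t -` B"
    by (auto simp: B_def u torus_proj_add)
  have shift [measurable]: "(+) c -` S \<in> sets borel" if "S \<in> sets borel" for c and S :: "(real^'n) set"
  proof -
    have "(+) c \<in> borel_measurable borel"
      by (intro borel_measurable_continuous_onI continuous_intros)
    from measurable_sets_borel [OF this that] show ?thesis .
  qed
  define X where "X k = (+) (- t) -` unit_cube \<inter> (+) (- l k) -` unit_cube \<inter> B" for k
  define Y where "Y k = (+) (- t) -` ((+) (l k) -` unit_cube) \<inter> unit_cube \<inter> B" for k
  have [measurable]: "X k \<in> sets borel" "Y k \<in> sets borel" for k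
    unfolding X_def Y_def by (intro sets.Int shift B sets_unit_cube)+
  have fl: "0 \<le> - of_int m + y \<and> - of_int m + y < 1 \<longleftrightarrow> m = \<lfloor>y\<rfloor>" for m and y :: real
    using floor_eq_iff [of y m] by linarith
  have mem: "- l k + x \<in> unit_cube \<longleftrightarrow> (\<forall>i. k $ i = \<lfloor>x $ i\<rfloor>)" for k x
    by (simp only: unit_cube_def mem_Collect_eq l_def vector_add_component vector_uminus_component
        vec_lambda_beta fl)
  have mem': "l k + x \<in> unit_cube \<longleftrightarrow> (\<forall>i. - k $ i = \<lfloor>x $ i\<rfloor>)" for k x
  proof -
    have "l (- k) = - l k" by (simp add: l_def vec_eq_iff)
    then show ?thesis using mem [of "- k" x] by simp
  qed
  have "(+) (l k) -` X k = Y k" for k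
    unfolding X_def Y_def by (auto simp: per add_diff_eq)
  then have XY: "emeasure lborel (X k) = emeasure lborel (Y k)" for k
    by (metis emeasure_lborel_vimage_plus \<open>X k \<in> sets borel\<close>)
  have UX: "(\<Union>k. X k) = (+) (- t) -` unit_cube \<inter> B"
  proof -
    have "\<exists>k. - l k + x \<in> unit_cube" for x
      unfolding mem by (rule exI [where x = "\<chi> i. \<lfloor>x $ i\<rfloor>"]) simp
    then show ?thesis by (auto simp: X_def)
  qed
  have UY: "(\<Union>k. Y k) = unit_cube \<inter> B"
  proof -
    have "\<exists>k. l k + (- t + x) \<in> unit_cube" for x
      unfolding mem' by (rule exI [where x = "\<chi> i. - \<lfloor>(- t + x) $ i\<rfloor>"]) simp
    then show ?thesis by (auto simp: Y_def)
  qed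
  have uniq: "m = n" if "- l m + x \<in> unit_cube" "- l n + x \<in> unit_cube" for m n x
    using that unfolding mem by (simp add: vec_eq_iff)
  have uniq': "m = n" if "l m + x \<in> unit_cube" "l n + x \<in> unit_cube" for m n x
    using that unfolding mem' by (simp add: vec_eq_iff) (metis neg_equal_iff_equal)
  have dX: "disjoint_family X"
    unfolding disjoint_family_on_def X_def by (blast dest: uniq)
  have dY: "disjoint_family Y"
    unfolding disjoint_family_on_def Y_def by (blast dest: uniq')
  have "emeasure torus_haar ((+) u -` A) = emeasure lborel (unit_cube \<inter> (+) t -` B)"
  proof -
    have "(+) u -` A \<in> sets borel"
    proof -
      have "continuous_on UNIV ((+) u)"
      proof -
        have "open ((+) u -` U)" if "open U" for U
        proof -
          have "torus_proj -` ((+) u -` U) = (+) t -` (torus_proj -` U)"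
            by (auto simp: u torus_proj_add)
          then show ?thesis using that
            by (auto simp: open_torus_def intro!: open_vimage continuous_intros)
        qed
        then show ?thesis by (simp add: continuous_on_open_vimage)
      qed
      then show ?thesis
        using measurable_sets_borel [OF borel_measurable_continuous_onI assms] by blast
    qed
    then show ?thesis by (simp add: emeasure_torus_haar vB)
  qed
  also have "\<dots> = emeasure lborel ((+) t -` ((+) (- t) -` unit_cube \<inter> B))"
    by (simp add: vimage_def Int_def)
  also have "\<dots> = emeasure lborel (\<Union>k. X k)"
    unfolding UX by (intro emeasure_lborel_vimage_plus sets.Int shift B sets_unit_cube)
  also have "\<dots> = (\<integral>\<^sup>+k. emeasure lborel (X k) \<partial>count_space UNIV)"
    by (rule emeasure_UN_countable) (auto simp: dX)
  also have "\<dots> = (\<integral>\<^sup>+k. emeasure lborel (Y k) \<partial>count_space UNIV)"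
    by (simp add: XY)
  also have "\<dots> = emeasure lborel (\<Union>k. Y k)"
    by (rule emeasure_UN_countable [symmetric]) (auto simp: dY)
  also have "\<dots> = emeasure torus_haar A"
    using assms by (simp add: UY B_def emeasure_torus_haar)
  finally show ?thesis .
qed

section \<open>Epimorphisms, automorphisms and mixing\<close>

definition torus_epi :: "('n::finite torus \<Rightarrow> 'n torus) \<Rightarrow> bool" where
  "torus_epi T \<longleftrightarrow> Modules.additive T \<and> continuous_on UNIV T \<and> surj T"

definition torus_auto :: "('n::finite torus \<Rightarrow> 'n torus) \<Rightarrow> bool" where
  "torus_auto T \<longleftrightarrow> Modules.additive T \<and> (\<exists>S. homeomorphism UNIV UNIV T S)"

definition mixing_epi :: "('n::finite torus \<Rightarrow> 'n torus) \<Rightarrow> bool" where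
  "mixing_epi T \<longleftrightarrow> torus_epi T \<and>
     (\<forall>A\<in>sets torus_haar. \<forall>B\<in>sets torus_haar.
        (\<lambda>n. measure torus_haar (A \<inter> (T ^^ n) -` B))
          \<longlonglongrightarrow> measure torus_haar A * measure torus_haar B)"

text \<open>The notion is only meant for finite sets of epimorphisms with more than one element; these
  side conditions are kept outside, so that the negation says that the limit relation fails for
  some choice of measurable sets.\<close>

definition mixing_set :: "('n::finite torus \<Rightarrow> 'n torus) set \<Rightarrow> bool" where
  "mixing_set F \<longleftrightarrow>
     (\<forall>B. (\<forall>\<gamma>\<in>F. B \<gamma> \<in> sets torus_haar) \<longrightarrow>
        (\<lambda>n. measure torus_haar (\<Inter>\<gamma>\<in>F. (\<gamma> ^^ n) -` B \<gamma>))
          \<longlonglongrightarrow> (\<Prod>\<gamma>\<in>F. measure torus_haar (B \<gamma>)))"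

section \<open>Characters and unipotent automorphisms\<close>

lift_definition torus_char :: "int ^ 'n \<Rightarrow> 'n::finite torus \<Rightarrow> complex" is
  "\<lambda>k x. cis (2 * pi * (\<Sum>i\<in>UNIV. of_int (k $ i) * x $ i))"
proof -
  fix k :: "int ^ 'n" and x y :: "real ^ 'n"
  assume "int_cong x y"
  then have "(\<Sum>i\<in>UNIV. of_int (k $ i) * (x $ i - y $ i)) \<in> \<int>"
    by (auto simp: int_cong_def intro!: Ints_sum Ints_mult)
  then obtain m :: int where "(\<Sum>i\<in>UNIV. of_int (k $ i) * (x $ i - y $ i)) = of_int m"
    by (auto elim: Ints_cases)
  then have eq: "2 * pi * (\<Sum>i\<in>UNIV. of_int (k $ i) * x $ i)
      = 2 * pi * (\<Sum>i\<in>UNIV. of_int (k $ i) * y $ i) + 2 * pi * of_int m"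
    by (simp add: right_diff_distrib sum_subtractf flip: distrib_left)
  show "cis (2 * pi * (\<Sum>i\<in>UNIV. of_int (k $ i) * x $ i))
      = cis (2 * pi * (\<Sum>i\<in>UNIV. of_int (k $ i) * y $ i))"
    unfolding eq by (simp add: cis_mult [symmetric] cis_multiple_2pi)
qed

text \<open>\<open>M\<close> is the matrix of \<open>\<chi> \<mapsto> \<chi> \<circ> T\<close> on the character group, which is identified with
  the lattice of integer vectors by means of \<^const>\<open>torus_char\<close>.\<close>

definition dual_matrix :: "('n::finite torus \<Rightarrow> 'n torus) \<Rightarrow> int ^ 'n ^ 'n \<Rightarrow> bool" where
  "dual_matrix T M \<longleftrightarrow> (\<forall>k. torus_char k \<circ> T = torus_char (M *v k))"

text \<open>The power is spelled out because \<open>^\<close> on vectors and matrices is componentwise.\<close>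

definition unipotent_matrix :: "int ^ 'n ^ 'n \<Rightarrow> bool" where
  "unipotent_matrix M \<longleftrightarrow> (\<exists>r. (((**) (M - mat 1)) ^^ r) (mat 1) = 0)"

definition unipotent_auto :: "('n::finite torus \<Rightarrow> 'n torus) \<Rightarrow> bool" where
  "unipotent_auto T \<longleftrightarrow> torus_auto T \<and> (\<exists>M. dual_matrix T M \<and> unipotent_matrix M)"

lemma torus_char_separates:
  assumes "\<And>k. torus_char k x = torus_char k y"
  shows "x = y"
proof -
  obtain a b where ab: "x = torus_proj a" "y = torus_proj b" by (metis torus_proj_cases)
  have "a $ i - b $ i \<in> \<int>" for i
  proof -
    have "cis (2 * pi * a $ i) = cis (2 * pi * b $ i)"
      using assms [of "axis i 1"] unfolding ab torus_char.abs_eq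
      by (simp add: axis_def if_distrib if_distribR cong: if_cong)
    then have "sin (2 * pi * a $ i) = sin (2 * pi * b $ i)"
      "cos (2 * pi * a $ i) = cos (2 * pi * b $ i)"
      by (simp_all add: cis.ctr)
    then obtain n :: int where "2 * pi * a $ i = 2 * pi * b $ i + 2 * pi * n"
      using sin_cos_eq_iff by metis
    then have "2 * pi * (a $ i - b $ i) = 2 * pi * n" by (simp add: algebra_simps)
    then show ?thesis by simp
  qed
  then show ?thesis by (simp add: ab torus_proj_eq_iff)
qed

text \<open>On the circle the identity is the only unipotent automorphism, so in dimension one there is
  no set of two unipotent automorphisms.\<close>

lemma unipotent_auto_dim_1:
  fixes T :: "'n::finite torus \<Rightarrow> 'n torus"
  assumes "CARD('n) = 1" "unipotent_auto T"
  shows "T = id"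
proof -
  obtain M where M: "dual_matrix T M" "unipotent_matrix M"
    using assms(2) by (auto simp: unipotent_auto_def)
  obtain i :: 'n where UNIV: "UNIV = {i}" using assms(1) by (auto simp: card_1_singleton_iff)
  then have all: "j = i" for j by auto
  obtain r where r: "(((**) (M - mat 1)) ^^ r) (mat 1) = 0"
    using M(2) by (auto simp: unipotent_matrix_def)
  have "(((**) (M - mat 1)) ^^ n) (mat 1) $ i $ i = (M $ i $ i - 1) ^ n" for n
    by (induction n) (simp_all add: matrix_matrix_mult_def mat_def UNIV)
  from this [of r] have "(M $ i $ i - 1) ^ r = 0"
    by (simp add: r)
  then have "M $ i $ i = 1" by simp
  then have "M $ j $ l = mat 1 $ j $ l" for j l
    using all [of j] all [of l] by (simp add: mat_def)
  then have "M = mat 1" by (simp add: vec_eq_iff)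
  with M(1) have "torus_char k (T x) = torus_char k x" for k x
    unfolding dual_matrix_def by (metis comp_apply matrix_vector_mul_lid)
  then have "T x = x" for x by (rule torus_char_separates)
  then show ?thesis by auto
qed

end

(* For endomorphisms with dual matrices M, the integral of a product of characters k_M composed with
   the n-th powers is 1 or 0 according to whether the sum of the vectors M^n k_M vanishes. Hence a
   finite set of endomorphisms is mixing iff every family (k_M) that is not identically zero satisfies
   this relation for only finitely many n.

   For unipotent M the relation is polynomial in n, so it holds for infinitely many n only if it holds
   for all n. Taking differences in n replaces k_M by (M - 1) k_M; by nilpotency, the set is therefore
   mixing as soon as the fixed spaces ker (M - 1) are linearly independent. For s > 2 take Jordan blocks
   with fixed lines spanned by e_1, ..., e_{s-1} and one more with fixed line spanned by
   e_1 + ... + e_{s-1}: any s - 1 of these lines are independent, but all s of them are not. For s = 2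
   take the identity and a Jordan block.

   Doubling the matrices multiplies the relation by 2^n and thus preserves all of this, but turns each
   map into a mixing epimorphism. For s = 2 the multiplications by 2 and -2 work, since they agree on
   even powers. *)

theory Submission
  imports Defs
begin

section \<open>Characters and torus endomorphisms\<close>

text \<open>The bound s <= d + 1 is linear algebra: s vectors satisfying one relation, any s - 1 of
  them independent, need a space of dimension s - 1. The step from infinitely many n to all n rests
  on integrality: a function whose differences are eventually positive integers is itself eventually
  positive, so sign behaviour passes up through repeated differences. The analytic burden is the
  passage between characters and sets of the completed sigma-algebra. Indicators are approximated in
  L1 by trigonometric polynomials; the error is uniform in n because the iterates preserve Haar
  measure, which is itself read off from Fourier coefficients. As \<open>torus\<close> is a bare
  quotient, regularity and Stone-Weierstrass are applied after embedding it as a product of circles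
  in a Euclidean space. Conversely, discs around 1 and -1 turn a relation among characters into an
  empty intersection of preimages, while the product of the measures is positive. Two maps are
  treated apart because the sum of a single basis vector is that vector again, so the last fixed
  line would coincide with the first.\<close>

lemma torus_char_proj:
  "torus_char k (torus_proj x) = cis (2 * pi * (\<Sum>i\<in>UNIV. of_int (k $ i) * x $ i))"
  by (rule torus_char.abs_eq)

lemma torus_char_zero [simp]: "torus_char 0 x = 1"
  by (cases x rule: torus_proj_cases) (simp add: torus_char_proj)

lemma torus_char_add: "torus_char (k + l) x = torus_char k x * torus_char l x"
  by (cases x rule: torus_proj_cases)
     (simp add: torus_char_proj cis_mult distrib_right sum.distrib distrib_left)

lemma torus_char_uminus: "torus_char (- k) x = cnj (torus_char k x)"
  by (cases x rule: torus_proj_cases) (simp add: torus_char_proj cis_cnj sum_negf)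

lemma torus_char_sum: "torus_char (sum f A) x = (\<Prod>a\<in>A. torus_char (f a) x)"
  by (induction A rule: infinite_finite_induct) (simp_all add: torus_char_add)

lemma norm_torus_char [simp]: "norm (torus_char k x) = 1"
  by (cases x rule: torus_proj_cases) (simp add: torus_char_proj)

lemma torus_char_plus: "torus_char k (x + y) = torus_char k x * torus_char k y"
proof -
  obtain a b where "x = torus_proj a" "y = torus_proj b" by (metis torus_proj_cases)
  then show ?thesis
    by (simp add: torus_proj_add [symmetric] torus_char_proj cis_mult sum.distrib distrib_left)
qed

text \<open>The universal property of the quotient topology: continuity can be tested on
  representatives.\<close>

lemma continuous_on_torusI:
  fixes f :: "'n::finite torus \<Rightarrow> 'b::topological_space"
  assumes "continuous_on UNIV (\<lambda>x. f (torus_proj x))"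
  shows "continuous_on UNIV f"
  using assms by (auto simp: continuous_on_open_vimage open_torus_def vimage_def)

lemma continuous_on_torus_char: "continuous_on UNIV (torus_char k)"
  by (rule continuous_on_torusI) (simp add: torus_char_proj, intro continuous_intros)

lemma measurable_torus_char [measurable]: "torus_char k \<in> borel_measurable borel"
  by (rule borel_measurable_continuous_onI [OF continuous_on_torus_char])

text \<open>The transpose of \<open>M\<close> acts on points, so that \<open>M\<close> itself acts
  on the indices of characters and is the dual matrix.\<close>

lift_definition torus_map :: "int ^ 'n ^ 'n \<Rightarrow> 'n::finite torus \<Rightarrow> 'n torus" is
  "\<lambda>M x. \<chi> i. \<Sum>j\<in>UNIV. of_int (M $ j $ i) * x $ j"
proof -
  fix M :: "int ^ 'n ^ 'n" and x y :: "real ^ 'n"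
  assume "int_cong x y"
  then have "(\<Sum>j\<in>UNIV. of_int (M $ j $ i) * (x $ j - y $ j)) \<in> \<int>" for i
    by (auto simp: int_cong_def intro!: Ints_sum Ints_mult)
  then show "int_cong (\<chi> i. \<Sum>j\<in>UNIV. of_int (M $ j $ i) * x $ j)
      (\<chi> i. \<Sum>j\<in>UNIV. of_int (M $ j $ i) * y $ j)"
    by (simp add: int_cong_def right_diff_distrib sum_subtractf)
qed

lemma torus_map_proj:
  "torus_map M (torus_proj x) = torus_proj (\<chi> i. \<Sum>j\<in>UNIV. of_int (M $ j $ i) * x $ j)"
  by (rule torus_map.abs_eq)

lemma torus_char_torus_map: "torus_char k (torus_map M x) = torus_char (M *v k) x"
proof (cases x rule: torus_proj_cases)
  case (1 a)
  have "(\<Sum>i\<in>UNIV. of_int (k $ i) * (\<Sum>j\<in>UNIV. of_int (M $ j $ i) * a $ j))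
      = (\<Sum>i\<in>UNIV. \<Sum>j\<in>UNIV. of_int (M $ j $ i) * of_int (k $ i) * a $ j)"
    by (simp add: sum_distrib_left mult_ac)
  also have "\<dots> = (\<Sum>j\<in>UNIV. of_int ((M *v k) $ j) * a $ j)"
    by (subst sum.swap) (simp add: matrix_vector_mult_def sum_distrib_right)
  finally show ?thesis by (simp add: 1 torus_map_proj torus_char_proj)
qed

lemma torus_char_funpow_torus_map:
  "torus_char k ((torus_map M ^^ n) x) = torus_char (((*v) M ^^ n) k) x"
proof (induction n arbitrary: k)
  case (Suc n)
  then show ?case by (simp add: torus_char_torus_map flip: funpow_swap1 [of "(*v) M"])
qed simp

lemma dual_matrix_torus_map: "dual_matrix (torus_map M) M"
  by (auto simp: dual_matrix_def torus_char_torus_map)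

lemma torus_map_one [simp]: "torus_map (mat 1) = id"
  by (rule ext, rule torus_char_separates) (simp add: torus_char_torus_map)

text \<open>The factors are reversed because passing to characters is contravariant. Like the other
  identities between torus maps, it is checked on characters, where it becomes an identity of
  integer vectors.\<close>

lemma torus_map_comp: "torus_map M (torus_map N x) = torus_map (N ** M) x"
  by (rule torus_char_separates) (simp add: torus_char_torus_map matrix_vector_mul_assoc)

definition double_matrix :: "int ^ 'n ^ 'n \<Rightarrow> int ^ 'n ^ 'n" where
  "double_matrix M = (\<chi> i j. 2 * M $ i $ j)"

lemma double_matrix_mult_vec: "double_matrix M *v k = 2 *s (M *v k)"
  by (simp add: double_matrix_def vec_eq_iff matrix_vector_mult_def sum_distrib_left mult.assoc)

lemma torus_map_double: "torus_map (double_matrix M) x = torus_map M x + torus_map M x"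
proof (rule torus_char_separates)
  have "2 *s v = v + v" for v :: "int ^ 'a" by (simp add: vec_eq_iff)
  then show "torus_char k (torus_map (double_matrix M) x) = torus_char k (torus_map M x + torus_map M x)" for k
    by (simp only: torus_char_torus_map torus_char_plus double_matrix_mult_vec torus_char_add)
qed

lemma additive_torus_map: "Modules.additive (torus_map M)"
  by standard (rule torus_char_separates, simp add: torus_char_torus_map torus_char_plus)

lemma continuous_on_torus_map: "continuous_on UNIV (torus_map M)"
proof (rule continuous_on_torusI)
  have "continuous_on UNIV (\<lambda>x. (\<chi> i. \<Sum>j\<in>UNIV. of_int (M $ j $ i) * x $ j) :: real ^ 'a)"
    by (intro continuous_intros)
  from continuous_on_compose2 [OF continuous_on_torus_proj this]
  show "continuous_on UNIV (\<lambda>x. torus_map M (torus_proj x))"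
    by (simp add: torus_map_proj)
qed

lemma measurable_torus_map [measurable]: "torus_map M \<in> borel_measurable borel"
  by (rule borel_measurable_continuous_onI [OF continuous_on_torus_map])

lemma measurable_funpow_torus_map [measurable]: "torus_map M ^^ n \<in> borel_measurable borel"
proof (induction n)
  case (Suc n)
  from measurable_comp [OF this measurable_torus_map] show ?case by simp
qed (simp add: id_def)

lemma torus_auto_torus_map:
  assumes "M ** N = mat 1" "N ** M = mat 1"
  shows "torus_auto (torus_map M)"
proof -
  have "torus_map M (torus_map N x) = x" "torus_map N (torus_map M x) = x" for x
    by (simp_all add: torus_map_comp assms)
  then have "homeomorphism UNIV UNIV (torus_map M) (torus_map N)"
    by (auto simp: homeomorphism_def continuous_on_torus_map intro: image_eqI [OF sym])
  then show ?thesis by (auto simp: torus_auto_def additive_torus_map)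
qed

lemma torus_epi_torus_map_double:
  assumes "M ** N = mat 1" "N ** M = mat 1"
  shows "torus_epi (torus_map (double_matrix M))"
proof -
  have "\<exists>x. torus_map (double_matrix M) x = y" for y
  proof -
    obtain b where b: "y = torus_proj b" by (rule torus_proj_cases)
    \<comment> \<open>A preimage of \<open>y\<close> is found by halving a representative before
      projecting and then applying the inverse \<open>N\<close>; doubling adds the two halves
      again.\<close>
    have "torus_map (double_matrix M) (torus_map N (torus_proj ((1/2) *\<^sub>R b))) = y"
      unfolding torus_map_double
      by (simp add: torus_map_comp assms b flip: torus_proj_add scaleR_left_distrib)
    then show ?thesis by blast
  qed
  then have "surj (torus_map (double_matrix M))" by (metis surjI)
  then show ?thesis
    by (simp add: torus_epi_def additive_torus_map continuous_on_torus_map)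
qed

section \<open>Haar measure on the Borel sets\<close>

text \<open>The measure before completion. Image measures and Fourier coefficients are handled here,
  where continuous maps are measurable; the completion returns only in the final step of the mixing
  criterion.\<close>

definition haar_borel :: "'n::finite torus measure" where
  "haar_borel = distr (uniform_measure lborel unit_cube) borel torus_proj"

lemma torus_haar_eq: "torus_haar = completion haar_borel"
  by (simp add: torus_haar_def haar_borel_def)

lemma sets_haar_borel [measurable_cong, simp]: "sets haar_borel = sets borel"
  by (simp add: haar_borel_def)

lemma space_haar_borel [simp]: "space haar_borel = UNIV"
  by (simp add: haar_borel_def)

lemma emeasure_haar_borel: "A \<in> sets borel \<Longrightarrow> emeasure haar_borel A = emeasure torus_haar A"
  by (simp add: torus_haar_eq)

lemma emeasure_haar_borel_UNIV [simp]: "emeasure haar_borel UNIV = 1"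
  by (simp add: emeasure_haar_borel emeasure_torus_haar_UNIV)

lemma finite_measure_haar_borel: "finite_measure haar_borel"
  by (rule finite_measureI) simp

lemma measurable_plus_torus [measurable]: "(+) (u :: 'n::finite torus) \<in> borel_measurable borel"
proof -
  obtain t where u: "u = torus_proj t" by (rule torus_proj_cases)
  have "continuous_on UNIV ((+) u)"
  proof (rule continuous_on_torusI)
    have "continuous_on UNIV (\<lambda>x. torus_proj (t + x))"
      by (rule continuous_on_compose2 [OF continuous_on_torus_proj]) (auto intro!: continuous_intros)
    then show "continuous_on UNIV (\<lambda>x. u + torus_proj x)" by (simp add: u torus_proj_add)
  qed
  then show ?thesis by (rule borel_measurable_continuous_onI)
qed

lemma distr_haar_borel_plus: "distr haar_borel borel ((+) u) = haar_borel"
proof (rule measure_eqI)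
  fix A assume "A \<in> sets (distr haar_borel borel ((+) u))"
  then have A: "A \<in> sets borel" by simp
  have "(+) u -` A \<in> sets borel" using measurable_sets_borel [OF measurable_plus_torus A] .
  with A show "emeasure (distr haar_borel borel ((+) u)) A = emeasure haar_borel A"
    by (simp add: emeasure_distr emeasure_haar_borel torus_haar_translation_invariant)
qed simp

text \<open>Put half a period into one coordinate with a nonzero entry. The value -1 serves twice:
  for the orthogonality of characters, and as the centre of the disc that obstructs mixing.\<close>

lemma torus_char_attains_minus_one:
  assumes "k \<noteq> 0"
  obtains x where "torus_char k x = - 1"
proof -
  obtain i where i: "k $ i \<noteq> 0" using assms by (auto simp: vec_eq_iff)
  have "torus_char k (torus_proj (axis i (1 / (2 * of_int (k $ i))))) = cis pi"
    using i by (simp add: torus_char_proj axis_def if_distrib if_distribR cong: if_cong)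
  then show ?thesis using that by simp
qed

text \<open>Translation by a point where the character is -1 negates the integrand but preserves the
  measure, so the integral equals its own negative.\<close>

lemma integral_torus_char: "integral\<^sup>L haar_borel (torus_char k) = (if k = 0 then 1 else 0)"
proof (cases "k = 0")
  case True
  then have "torus_char k = (\<lambda>x. 1)" by auto
  with True show ?thesis by (simp add: measure_def)
next
  case False
  then obtain u where u: "torus_char k u = - 1" by (rule torus_char_attains_minus_one)
  have "integral\<^sup>L haar_borel (torus_char k) = (\<integral>x. torus_char k (u + x) \<partial>haar_borel)"
    by (subst distr_haar_borel_plus [of u, symmetric]) (simp add: integral_distr)
  also have "\<dots> = - integral\<^sup>L haar_borel (torus_char k)"
    by (simp add: torus_char_plus u)
  finally show ?thesis using False by simp
qed

text \<open>If the characters agree, the one with index \<open>k - l\<close> is constantly 1, so its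
  integral is 1 and the index must be 0.\<close>

lemma inj_torus_char: "torus_char k = torus_char l \<Longrightarrow> k = l"
proof -
  assume eq: "torus_char k = torus_char l"
  have "torus_char (k - l) = (\<lambda>x. torus_char l x * cnj (torus_char l x))"
    using torus_char_add [of k "- l"] by (auto simp: torus_char_uminus eq)
  also have "\<dots> = torus_char 0"
    by (auto simp: complex_norm_square [symmetric])
  finally have "torus_char (k - l) = torus_char 0" .
  from arg_cong [OF this, of "integral\<^sup>L haar_borel"] show "k = l"
    unfolding integral_torus_char by (simp split: if_splits)
qed

text \<open>Lets cardinalities, intersections and products over a set of maps be computed over the
  set of their matrices.\<close>

lemma inj_torus_map: "inj torus_map"
proof (rule injI)
  fix M N :: "int ^ 'a ^ 'a"
  assume "torus_map M = torus_map N"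
  then have "torus_char (M *v k) = torus_char (N *v k)" for k
    by (auto simp flip: torus_char_torus_map)
  then show "M = N" by (auto simp: matrix_eq dest: inj_torus_char)
qed

section \<open>Unipotent integer matrices\<close>

lemma funpow_mult_vec_diff:
  fixes M :: "int ^ 'n ^ 'n"
  shows "((*v) M ^^ n) (k - l) = ((*v) M ^^ n) k - ((*v) M ^^ n) l"
  by (induction n) (simp_all add: matrix_vector_mult_diff_distrib)

lemma funpow_mult_vec_zero [simp]:
  fixes M :: "int ^ 'n ^ 'n"
  shows "((*v) M ^^ n) 0 = 0"
  by (induction n) simp_all

lemma funpow_mult_vec_commute:
  fixes M :: "int ^ 'n ^ 'n"
  shows "M *v ((*v) M ^^ n) k = ((*v) M ^^ n) (M *v k)"
  by (rule funpow_swap1)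

lemma funpow_mult_vec_fixed:
  fixes M :: "int ^ 'n ^ 'n"
  assumes "M *v k = k"
  shows "((*v) M ^^ n) k = k"
  by (induction n) (simp_all add: assms)

lemma funpow_mult_vec_eq_0_iff:
  fixes M :: "int ^ 'n ^ 'n"
  assumes "N ** M = mat 1"
  shows "((*v) M ^^ n) k = 0 \<longleftrightarrow> k = 0"
proof (induction n)
  case (Suc n)
  have "M *v v = 0 \<longleftrightarrow> v = 0" for v
    by (metis assms matrix_vector_mul_assoc matrix_vector_mul_lid matrix_vector_mult_0_right)
  with Suc show ?case by simp
qed simp

text \<open>Replaces the count of zeros of a polynomial. A positive integer difference is at least
  1, so an eventually positive difference makes the function grow without bound; a zero difference
  makes it constant. Real values would not suffice.\<close>

lemma int_difference_trichotomy:
  fixes f :: "nat \<Rightarrow> int"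
  assumes "(\<forall>n. f (Suc n) - f n = 0) \<or> (\<forall>\<^sub>F n in sequentially. f (Suc n) - f n > 0)
    \<or> (\<forall>\<^sub>F n in sequentially. f (Suc n) - f n < 0)"
  shows "(\<forall>n. f n = 0) \<or> (\<forall>\<^sub>F n in sequentially. f n > 0) \<or> (\<forall>\<^sub>F n in sequentially. f n < 0)"
proof -
  have pos: "\<forall>\<^sub>F n in sequentially. g n > 0"
    if g: "\<forall>\<^sub>F n in sequentially. g (Suc n) - g n > 0" for g :: "nat \<Rightarrow> int"
  proof -
    obtain m where m: "\<And>n. n \<ge> m \<Longrightarrow> g (Suc n) - g n > 0"
      using g unfolding eventually_sequentially by blast
    have growth: "g (m + j) \<ge> g m + int j" for j
    proof (induction j)
      case (Suc j)
      then show ?case using m [of "m + j"] by simp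
    qed simp
    \<comment> \<open>From \<open>m\<close> on, \<open>g\<close> gains at least 1 in each step, so
      after \<open>1 + \<bar>g m\<bar>\<close> steps it has made up for a negative start.\<close>
    have "g n > 0" if "n \<ge> m + nat (1 + \<bar>g m\<bar>)" for n
      using that growth [of "n - m"] by simp
    then show ?thesis by (auto simp: eventually_sequentially)
  qed
  from assms consider "\<forall>n. f (Suc n) - f n = 0" | "\<forall>\<^sub>F n in sequentially. f (Suc n) - f n > 0"
    | "\<forall>\<^sub>F n in sequentially. f (Suc n) - f n < 0" by blast
  then show ?thesis
  proof cases
    case 1
    define c where "c = f 0"
    have "f n = c" for n
      by (induction n) (use 1 in \<open>simp_all add: c_def\<close>)
    then show ?thesis by (cases c "0 :: int" rule: linorder_cases) simp_all
  next
    case 2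
    then show ?thesis using pos [of f] by blast
  next
    case 3
    have "\<forall>\<^sub>F n in sequentially. - f n > 0" by (rule pos) (use 3 in simp)
    then show ?thesis by simp
  qed
qed

text \<open>The vanishing is stated for all \<open>s \<ge> r\<close> so that finitely many matrices
  can share one exponent.\<close>

lemma unipotent_matrix_nilpotent:
  assumes "unipotent_matrix M"
  obtains r where "\<And>s k. s \<ge> r \<Longrightarrow> ((\<lambda>k. M *v k - k) ^^ s) k = 0"
proof -
  obtain r where r: "(((**) (M - mat 1)) ^^ r) (mat 1) = 0"
    using assms by (auto simp: unipotent_matrix_def)
  have eq: "((\<lambda>k. M *v k - k) ^^ s) k = (((**) (M - mat 1)) ^^ s) (mat 1) *v k" for s k
  proof (induction s)
    case (Suc s)
    have "M *v v - v = (M - mat 1) *v v" for v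
      by (simp add: matrix_vector_mult_diff_rdistrib)
    with Suc show ?case by (simp add: matrix_vector_mul_assoc)
  qed simp
  have "(((**) (M - mat 1)) ^^ (s + r)) (mat 1) = 0" for s
    by (induction s) (simp_all add: r)
  then have "((\<lambda>k. M *v k - k) ^^ (s + r)) k = 0" for s k
    by (simp only: eq matrix_vector_mult_0)
  from this [of "s - r" k for s k] have "((\<lambda>k. M *v k - k) ^^ s) k = 0" if "s \<ge> r" for s k
    using that le_add_diff_inverse2 [OF that] by metis
  then show ?thesis by (rule that)
qed

text \<open>Functions with this trichotomy are not closed under addition, so the induction on the
  common nilpotency order treats the whole sum at once and not each matrix separately.\<close>

lemma unipotent_sum_trichotomy:
  fixes \<kappa> :: "int ^ 'n ^ 'n \<Rightarrow> int ^ 'n"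
  assumes "\<And>M. M \<in> Ms \<Longrightarrow> ((\<lambda>k. M *v k - k) ^^ r) (\<kappa> M) = 0"
  defines "f \<equiv> \<lambda>i n. (\<Sum>M\<in>Ms. ((*v) M ^^ n) (\<kappa> M)) $ i"
  shows "(\<forall>n. f i n = 0) \<or> (\<forall>\<^sub>F n in sequentially. f i n > 0)
    \<or> (\<forall>\<^sub>F n in sequentially. f i n < 0)"
  using assms(1) unfolding f_def
proof (induction r arbitrary: \<kappa>)
  case 0
  then show ?case by simp
next
  case (Suc r)
  have eq: "(\<Sum>M\<in>Ms. ((*v) M ^^ Suc n) (\<kappa> M)) $ i - (\<Sum>M\<in>Ms. ((*v) M ^^ n) (\<kappa> M)) $ i
      = (\<Sum>M\<in>Ms. ((*v) M ^^ n) (M *v \<kappa> M - \<kappa> M)) $ i" for n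
    by (simp add: funpow_mult_vec_diff sum_subtractf funpow_mult_vec_commute)
  have "((\<lambda>k. M *v k - k) ^^ r) (M *v \<kappa> M - \<kappa> M) = 0" if "M \<in> Ms" for M
    using Suc.prems [OF that] unfolding funpow_Suc_right by simp
  from Suc.IH [OF this] show ?case
    unfolding eq [symmetric] by (rule int_difference_trichotomy)
qed

text \<open>The induction hypothesis, applied to the differenced relation, says that every
  \<open>M *v \<kappa> M - \<kappa> M\<close> vanishes. So all vectors are fixed, and the relation
  at n = 0 is one between fixed vectors, to which \<open>indep\<close> applies.\<close>

lemma unipotent_sum_eq_0:
  fixes \<kappa> :: "int ^ 'n ^ 'n \<Rightarrow> int ^ 'n"
  assumes indep: "\<And>\<kappa>. (\<And>M. M \<in> Ms \<Longrightarrow> M *v \<kappa> M = \<kappa> M) \<Longrightarrow> (\<Sum>M\<in>Ms. \<kappa> M) = 0 \<Longrightarrow> \<forall>M\<in>Ms. \<kappa> M = 0"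
    and "\<And>M. M \<in> Ms \<Longrightarrow> ((\<lambda>k. M *v k - k) ^^ r) (\<kappa> M) = 0"
    and "\<And>n. (\<Sum>M\<in>Ms. ((*v) M ^^ n) (\<kappa> M)) = 0"
  shows "\<forall>M\<in>Ms. \<kappa> M = 0"
  using assms(2,3)
proof (induction r arbitrary: \<kappa>)
  case 0
  then show ?case by simp
next
  case (Suc r)
  have "(\<Sum>M\<in>Ms. ((*v) M ^^ n) (M *v \<kappa> M - \<kappa> M)) = 0" for n
    using Suc.prems(2) [of n] Suc.prems(2) [of "Suc n"]
    by (simp add: funpow_mult_vec_diff sum_subtractf funpow_mult_vec_commute)
  moreover have "((\<lambda>k. M *v k - k) ^^ r) (M *v \<kappa> M - \<kappa> M) = 0" if "M \<in> Ms" for M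
    using Suc.prems(1) [OF that] unfolding funpow_Suc_right by simp
  ultimately have "\<forall>M\<in>Ms. M *v \<kappa> M - \<kappa> M = 0" by (intro Suc.IH)
  with Suc.prems(2) [of 0] show ?case by (intro indep) simp_all
qed

lemma unipotent_relation_finite:
  fixes \<kappa> :: "int ^ 'n::finite ^ 'n \<Rightarrow> int ^ 'n"
  assumes "finite Ms"
    and unip: "\<And>M. M \<in> Ms \<Longrightarrow> unipotent_matrix M"
    and indep: "\<And>\<kappa>. (\<And>M. M \<in> Ms \<Longrightarrow> M *v \<kappa> M = \<kappa> M) \<Longrightarrow> (\<Sum>M\<in>Ms. \<kappa> M) = 0 \<Longrightarrow> \<forall>M\<in>Ms. \<kappa> M = 0"
    and "\<exists>M\<in>Ms. \<kappa> M \<noteq> 0"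
  shows "finite {n. (\<Sum>M\<in>Ms. ((*v) M ^^ n) (\<kappa> M)) = 0}"
proof (rule ccontr)
  assume inf: "infinite {n. (\<Sum>M\<in>Ms. ((*v) M ^^ n) (\<kappa> M)) = 0}"
  have "\<forall>M\<in>Ms. \<exists>r. \<forall>s\<ge>r. \<forall>k. ((\<lambda>k. M *v k - k) ^^ s) k = 0"
    using unip unipotent_matrix_nilpotent by metis
  then obtain r where r: "\<And>M s k. M \<in> Ms \<Longrightarrow> s \<ge> r M \<Longrightarrow> ((\<lambda>k. M *v k - k) ^^ s) k = 0"
    by metis
  \<comment> \<open>The sum dominates every single exponent, and it makes sense for an empty family
    too.\<close>
  define R where "R = sum r Ms"
  have R: "((\<lambda>k. M *v k - k) ^^ R) k = 0" if "M \<in> Ms" for M k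
    using that r by (simp add: R_def member_le_sum \<open>finite Ms\<close>)
  have comp: "(\<Sum>M\<in>Ms. ((*v) M ^^ n) (\<kappa> M)) $ i = 0" for n i
  proof -
    \<comment> \<open>Zeros at infinitely many n exclude both strict signs, which leaves the
      identically zero alternative in each coordinate.\<close>
    have not_ev: "\<not> eventually P sequentially"
      if "\<And>n. (\<Sum>M\<in>Ms. ((*v) M ^^ n) (\<kappa> M)) = 0 \<Longrightarrow> \<not> P n" for P
      using inf that unfolding eventually_sequentially infinite_nat_iff_unbounded_le by blast
    have "\<not> (\<forall>\<^sub>F n in sequentially. (\<Sum>M\<in>Ms. ((*v) M ^^ n) (\<kappa> M)) $ i > 0)"
      "\<not> (\<forall>\<^sub>F n in sequentially. (\<Sum>M\<in>Ms. ((*v) M ^^ n) (\<kappa> M)) $ i < 0)"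
      by (rule not_ev; simp only: zero_index; simp)+
    then show ?thesis using unipotent_sum_trichotomy [of Ms R \<kappa> i, OF R] by blast
  qed
  have "(\<Sum>M\<in>Ms. ((*v) M ^^ n) (\<kappa> M)) = 0" for n
    by (rule vec_eq_iff [THEN iffD2]) (simp only: comp zero_index simp_thms)
  with unipotent_sum_eq_0 [OF indep R] assms(4) show False by blast
qed

section \<open>Inverses and conjugates of unipotent matrices\<close>

lemma matrix_diff_ldistrib:
  fixes A B C :: "int ^ 'n::finite ^ 'n"
  shows "A ** (B - C) = A ** B - A ** C"
  by (simp add: vec_eq_iff matrix_matrix_mult_def right_diff_distrib sum_subtractf)

lemma matrix_diff_rdistrib:
  fixes A B C :: "int ^ 'n::finite ^ 'n"
  shows "(B - C) ** A = B ** A - C ** A"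
  by (simp add: vec_eq_iff matrix_matrix_mult_def left_diff_distrib sum_subtractf)

text \<open>The geometric series for the inverse of 1 + A is finite because A is nilpotent, and it
  involves no division, so the inverse has integer entries.\<close>

lemma unipotent_matrix_invertible:
  fixes M :: "int ^ 'n::finite ^ 'n"
  assumes "unipotent_matrix M"
  obtains N where "M ** N = mat 1" "N ** M = mat 1"
proof -
  define A where "A = M - mat 1"
  \<comment> \<open>Partial sums 1 - A + A^2 - ..., written as iterates of a map whose fixed points
    are the right inverses of \<open>M\<close>. Consecutive iterates differ by a power of A up to
    sign, so the sequence becomes stationary.\<close>
  define B where "B r = ((\<lambda>X. mat 1 - A ** X) ^^ r) 0" for r
  obtain r where r: "((**) A ^^ r) (mat 1) = 0"
    using assms by (auto simp: unipotent_matrix_def A_def)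
  have diff: "B (Suc r) - B r = ((**) A ^^ r) (mat 1) \<or> B (Suc r) - B r = - ((**) A ^^ r) (mat 1)" for r
  proof (induction r)
    case (Suc r)
    have "B (Suc (Suc r)) - B (Suc r) = - (A ** (B (Suc r) - B r))"
      by (simp add: B_def matrix_diff_ldistrib)
    moreover have "A ** - X = - (A ** X)" for X :: "int ^ 'n ^ 'n"
      using matrix_diff_ldistrib [of A 0 X] by simp
    ultimately show ?case using Suc by fastforce
  qed (simp add: B_def)
  have comm: "A ** B r = B r ** A" for r
  proof (induction r)
    case (Suc r)
    have "B (Suc r) ** A = A - A ** (B r ** A)"
      by (simp add: B_def matrix_diff_rdistrib matrix_mul_assoc)
    also have "\<dots> = A ** B (Suc r)"
      using Suc by (simp add: B_def matrix_diff_ldistrib matrix_mul_assoc)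
    finally show ?case ..
  qed (simp add: B_def)
  have "B (Suc r) - B r = 0" using diff [of r] r by simp
  then have "B (Suc r) = B r" by simp
  moreover have "B (Suc r) = mat 1 - A ** B r" by (simp add: B_def)
  ultimately have "B r = mat 1 - A ** B r" by simp
  then have "B r + A ** B r = mat 1" by (simp only: eq_diff_eq)
  then have "M ** B r = mat 1"
    by (simp add: A_def matrix_diff_rdistrib)
  moreover have "B r ** M = M ** B r"
    using comm [of r] by (simp add: A_def matrix_diff_rdistrib matrix_diff_ldistrib)
  ultimately have "M ** B r = mat 1" "B r ** M = mat 1" by simp_all
  then show ?thesis using that by blast
qed

lemma unipotent_matrix_conj:
  fixes M A B :: "int ^ 'n::finite ^ 'n"
  assumes "unipotent_matrix M" "A ** B = mat 1" "B ** A = mat 1"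
  shows "unipotent_matrix (A ** M ** B)"
proof -
  have conj: "A ** M ** B - mat 1 = A ** (M - mat 1) ** B"
    by (simp add: matrix_diff_ldistrib matrix_diff_rdistrib assms)
  have "((**) (A ** (M - mat 1) ** B) ^^ r) (mat 1) = A ** ((**) (M - mat 1) ^^ r) (mat 1) ** B" for r
  proof (induction r)
    case (Suc r)
    have "A ** (M - mat 1) ** B ** (A ** X ** B) = A ** (M - mat 1) ** (B ** A) ** X ** B" for X
      by (simp only: matrix_mul_assoc)
    with Suc show ?case by (simp add: assms matrix_mul_assoc)
  qed (simp add: assms)
  moreover obtain r where "((**) (M - mat 1) ^^ r) (mat 1) = 0"
    using assms(1) by (auto simp: unipotent_matrix_def)
  ultimately have "((**) (A ** M ** B - mat 1) ^^ r) (mat 1) = 0"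
    by (simp add: conj)
  then show ?thesis by (auto simp: unipotent_matrix_def)
qed

text \<open>Number the coordinates so that \<open>j\<close> comes first, and let A move each entry
  one place down the numbering. A vector is killed by A exactly if all its entries except the first
  vanish, so the fixed space of 1 + A is the line of \<open>axis j 1\<close>.\<close>

lemma ex_jordan_block:
  fixes j :: "'n::finite"
  obtains M :: "int ^ 'n ^ 'n" where "unipotent_matrix M" "M *v axis j 1 = axis j 1"
    "\<And>k. M *v k = k \<Longrightarrow> \<exists>c. k = c *s axis j 1"
proof -
  obtain g0 :: "'n \<Rightarrow> nat" where g0: "bij_betw g0 UNIV {0..<CARD('n)}"
    using ex_bij_betw_finite_nat [of "UNIV :: 'n set"] by auto
  have "0 \<in> range g0" using g0 by (simp add: bij_betw_def)
  then obtain a where a: "g0 a = 0" by auto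
  \<comment> \<open>The swap gives \<open>j\<close> the number 0 in an otherwise arbitrary
    numbering.\<close>
  define g where "g = g0 \<circ> Transposition.transpose j a"
  have g: "bij_betw g UNIV {0..<CARD('n)}"
    unfolding g_def by (rule bij_betw_trans [OF _ g0]) (simp add: bij_betw_def)
  have gj: "g j = 0" by (simp add: g_def a)
  have inj: "g x = g y \<longleftrightarrow> x = y" for x y
    using g by (auto simp: bij_betw_def inj_eq)
  define A :: "int ^ 'n ^ 'n" where "A = (\<chi> i l. if g l = Suc (g i) then 1 else 0)"
  define M where "M = mat 1 + A"
  \<comment> \<open>The r-th power of A is supported on the r-th superdiagonal, which is empty for r
    = \<open>CARD('n)\<close>.\<close>
  have supp: "(((**) A ^^ r) (mat 1)) $ i $ l \<noteq> 0 \<Longrightarrow> g l = g i + r" for r i l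
  proof (induction r arbitrary: i)
    case 0
    then show ?case by (simp add: mat_def split: if_splits)
  next
    case (Suc r)
    have "(A ** X) $ i $ l = (\<Sum>m\<in>UNIV. A $ i $ m * X $ m $ l)" for X :: "int ^ 'n ^ 'n"
      by (simp add: matrix_matrix_mult_def)
    with Suc.prems have "(\<Sum>m\<in>UNIV. A $ i $ m * ((**) A ^^ r) (mat 1) $ m $ l) \<noteq> 0"
      by simp
    then obtain m where "A $ i $ m * ((**) A ^^ r) (mat 1) $ m $ l \<noteq> 0"
      by (meson sum.not_neutral_contains_not_neutral)
    with Suc.IH [of m] show ?case by (simp add: A_def split: if_splits)
  qed
  have less: "g l < CARD('n)" for l using g by (auto simp: bij_betw_def)
  have "((**) A ^^ CARD('n)) (mat 1) $ i $ l = 0" for i l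
    using supp [of "CARD('n)" i l] less [of l] by linarith
  then have unip: "unipotent_matrix M"
    unfolding unipotent_matrix_def M_def by (auto simp: vec_eq_iff intro!: exI [of _ "CARD('n)"])
  have M: "M *v k = k \<longleftrightarrow> A *v k = 0" for k
    by (simp add: M_def matrix_vector_mult_add_rdistrib)
  have Ak: "(A *v k) $ i = k $ l" if "g l = Suc (g i)" for k i l
  proof -
    have "(A *v k) $ i = (\<Sum>m\<in>UNIV. if m = l then k $ m else 0)"
      by (simp add: matrix_vector_mult_def A_def that [symmetric] inj if_distrib [of "\<lambda>x. x * _"] cong: if_cong)
    also have "\<dots> = k $ l" by simp
    finally show ?thesis .
  qed
  have "(A *v axis j 1) $ i = 0" for i
    by (auto simp: matrix_vector_mult_def A_def axis_def gj intro!: sum.neutral)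
  then have fixed: "M *v axis j 1 = axis j 1" unfolding M by (simp add: vec_eq_iff)
  have "\<exists>c. k = c *s axis j 1" if "M *v k = k" for k
  proof -
    have "k $ l = 0" if "l \<noteq> j" for l
    proof -
      have "g l \<noteq> 0" using that gj inj by metis
      then have "g l - 1 \<in> {0..<CARD('n)}" using less [of l] by simp
      then have "g l - 1 \<in> range g" using g by (simp add: bij_betw_def)
      then obtain i where "g l - 1 = g i" by blast
      then have "g l = Suc (g i)" using \<open>g l \<noteq> 0\<close> by simp
      from Ak [OF this, of k] show ?thesis using \<open>M *v k = k\<close> by (simp add: M)
    qed
    then have "k = (k $ j) *s axis j 1" by (auto simp: vec_eq_iff axis_def)
    then show ?thesis by blast
  qed
  with unip fixed show ?thesis using that by blast
qed

text \<open>A conjugate of the Jordan block by the shear that maps \<open>axis j 1\<close> to the sum of the basis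
  vectors in \<open>S\<close>.\<close>

lemma ex_unipotent_fixing_sum:
  fixes S :: "'n::finite set"
  assumes "S \<noteq> {}"
  defines "q \<equiv> \<chi> i. if i \<in> S then 1 else 0"
  obtains M :: "int ^ 'n ^ 'n" where "unipotent_matrix M" "M *v q = q"
    "\<And>k. M *v k = k \<Longrightarrow> \<exists>c. k = c *s q"
proof -
  obtain j where j: "j \<in> S" using assms by blast
  obtain M :: "int ^ 'n ^ 'n" where M: "unipotent_matrix M" "M *v axis j 1 = axis j 1"
    "\<And>k. M *v k = k \<Longrightarrow> \<exists>c. k = c *s axis j 1"
    using ex_jordan_block by blast
  \<comment> \<open>E copies entry \<open>j\<close> into the other entries of \<open>S\<close>. Its
    values have entry \<open>j\<close> equal to 0, so E squared is 0 and 1 - E inverts 1 +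
    E.\<close>
  define E :: "int ^ 'n ^ 'n" where "E = (\<chi> i l. if l = j \<and> i \<in> S - {j} then 1 else 0)"
  have E: "E *v k = (\<chi> i. if i \<in> S - {j} then k $ j else 0)" for k
  proof -
    have "(\<Sum>l\<in>UNIV. E $ i $ l * k $ l) = (\<Sum>l\<in>UNIV. if l = j then E $ i $ j * k $ j else 0)" for i
      by (intro sum.cong) (auto simp: E_def)
    then show ?thesis by (simp add: vec_eq_iff matrix_vector_mult_def) (simp add: E_def)
  qed
  define A where "A = mat 1 + E"
  define B where "B = mat 1 - E"
  have A: "A *v k = k + E *v k" for k by (simp add: A_def matrix_vector_mult_add_rdistrib)
  have B: "B *v k = k - E *v k" for k by (simp add: B_def matrix_vector_mult_diff_rdistrib)
  have AB: "A ** B = mat 1" "B ** A = mat 1"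
    unfolding matrix_eq matrix_vector_mul_assoc [symmetric] A B by (simp_all add: E vec_eq_iff)
  have Aj: "A *v axis j 1 = q"
    using j by (auto simp: A E q_def vec_eq_iff axis_def)
  have Bq: "B *v q = axis j 1"
    by (simp add: Aj [symmetric] matrix_vector_mul_assoc AB)
  show ?thesis
  proof
    show "unipotent_matrix (A ** M ** B)" by (rule unipotent_matrix_conj [OF M(1) AB])
    show "(A ** M ** B) *v q = q"
      by (simp add: Bq M(2) Aj flip: matrix_vector_mul_assoc)
    fix k assume "(A ** M ** B) *v k = k"
    then have "B *v ((A ** M ** B) *v k) = B *v k" by simp
    then have "M *v (B *v k) = B *v k" by (simp add: matrix_vector_mul_assoc matrix_mul_assoc AB)
    then obtain c where "B *v k = c *s axis j 1" using M(3) by blast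
    then have "A *v (B *v k) = A *v (c *s axis j 1)" by simp
    moreover have "A *v (c *s v) = c *s (A *v v)" for v
      by (simp add: vec_eq_iff matrix_vector_mult_def sum_distrib_left mult_ac)
    ultimately have "k = c *s q"
      by (simp add: matrix_vector_mul_assoc AB) (simp add: Aj)
    then show "\<exists>c. k = c *s q" ..
  qed
qed

text \<open>The fixed lines are spanned by s - 1 basis vectors and by their sum \<open>q\<close>. Up
  to scaling, these s vectors satisfy exactly one relation, and all its coefficients are nonzero, so
  it does not survive the omission of any vector.\<close>

lemma ex_minimally_dependent_unipotents:
  assumes "3 \<le> s" "s \<le> CARD('n::finite) + 1"
  obtains Ms :: "(int ^ 'n ^ 'n) set" and \<kappa> where
    "finite Ms" "card Ms = s" "\<And>M. M \<in> Ms \<Longrightarrow> unipotent_matrix M"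
    "\<And>M. M \<in> Ms \<Longrightarrow> M *v \<kappa> M = \<kappa> M" "\<And>M. M \<in> Ms \<Longrightarrow> \<kappa> M \<noteq> 0" "(\<Sum>M\<in>Ms. \<kappa> M) = 0"
    "\<And>\<mu> Ns. Ns \<subset> Ms \<Longrightarrow> \<forall>M\<in>Ns. M *v \<mu> M = \<mu> M \<Longrightarrow> (\<Sum>M\<in>Ns. \<mu> M) = 0
       \<Longrightarrow> \<forall>M\<in>Ns. \<mu> M = 0"
proof -
  have "s - 1 \<le> card (UNIV :: 'n set)" using assms by simp
  then obtain S :: "'n set" where S: "card S = s - 1" by (meson obtain_subset_with_card_n)
  have finS: "finite S" by simp
  have "S \<noteq> {}" using S assms by auto
  define q :: "int ^ 'n" where "q = (\<chi> i. if i \<in> S then 1 else 0)"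
  obtain V :: "int ^ 'n ^ 'n" where V: "unipotent_matrix V" "V *v q = q"
    "\<And>k. V *v k = k \<Longrightarrow> \<exists>c. k = c *s q"
    using ex_unipotent_fixing_sum [OF \<open>S \<noteq> {}\<close>] unfolding q_def by blast
  have "\<exists>M :: int ^ 'n ^ 'n. unipotent_matrix M \<and> M *v axis j 1 = axis j 1
      \<and> (\<forall>k. M *v k = k \<longrightarrow> (\<exists>c. k = c *s axis j 1))" for j
    by (rule ex_jordan_block [of j]) blast
  then obtain U :: "'n \<Rightarrow> int ^ 'n ^ 'n" where U: "unipotent_matrix (U j)"
    "U j *v axis j 1 = axis j 1" "U j *v k = k \<Longrightarrow> \<exists>c. k = c *s axis j 1" for j k
    by metis
  have inj: "inj U"
  proof (rule injI)
    fix i j assume "U i = U j"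
    then have "U j *v axis i 1 = axis i 1" using U(2) by metis
    then obtain c where "axis i 1 = c *s (axis j 1 :: int ^ 'n)" using U(3) by blast
    then have "axis i 1 $ i = (c *s (axis j 1 :: int ^ 'n)) $ i" by simp
    then show "i = j" by (simp add: axis_def split: if_splits)
  qed
  \<comment> \<open>Here s >= 3 enters: \<open>S\<close> has at least two elements, so
    \<open>q\<close> is not a multiple of a basis vector.\<close>
  have VU: "V \<noteq> U j" for j
  proof
    assume "V = U j"
    then obtain c where c: "q = c *s axis j 1" using V(2) U(3) by blast
    have "\<not> S \<subseteq> {j}" using S assms card_mono [of "{j}" S] by auto
    then obtain i where i: "i \<in> S" "i \<noteq> j" by blast
    have "q $ i = (c *s axis j 1) $ i" using c by simp
    with i show False by (simp add: q_def axis_def)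
  qed
  define Ms where "Ms = insert V (U ` S)"
  have notin: "V \<notin> U ` S" using VU by blast
  have sum_Ms: "(\<Sum>M\<in>Ms. \<mu> M) = \<mu> V + (\<Sum>j\<in>S. \<mu> (U j))" for \<mu> :: "_ \<Rightarrow> int ^ 'n"
    using inj notin finS by (simp add: Ms_def sum.reindex inj_on_subset [OF inj])
  have q_sum: "q = (\<Sum>j\<in>S. axis j 1)"
    by (simp add: vec_eq_iff q_def axis_def)
  \<comment> \<open>The coefficients of the unique relation: -1 at \<open>q\<close> and 1 at each
    basis vector.\<close>
  define \<kappa> where "\<kappa> M = (if M = V then - q else axis (inv U M) 1)" for M
  have \<kappa>: "\<kappa> V = - q" "\<kappa> (U j) = axis j 1" for j
    using VU [of j] inj by (auto simp: \<kappa>_def)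
  have indep: "\<forall>M\<in>Ns. \<mu> M = 0" if Ns: "Ns \<subset> Ms" and fixed: "\<forall>M\<in>Ns. M *v \<mu> M = \<mu> M"
    and sum0: "(\<Sum>M\<in>Ns. \<mu> M) = 0" for \<mu> Ns
  proof -
    \<comment> \<open>Extending by 0 turns a relation over \<open>Ns\<close> into one over
      \<open>Ms\<close> in which some coefficient is known to vanish.\<close>
    define \<nu> where "\<nu> M = (if M \<in> Ns then \<mu> M else 0)" for M
    have \<nu>_fixed: "M *v \<nu> M = \<nu> M" for M by (simp add: \<nu>_def fixed)
    obtain c0 where c0: "\<nu> V = c0 *s q" using V(3) \<nu>_fixed by blast
    have "\<forall>j. \<exists>c. \<nu> (U j) = c *s axis j 1" using U(3) \<nu>_fixed by blast
    then obtain c where c: "\<And>j. \<nu> (U j) = c j *s axis j 1" by (auto dest: choice)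
    have "(\<Sum>M\<in>Ms. \<nu> M) = (\<Sum>M\<in>Ns. \<nu> M)"
      using Ns by (intro sum.mono_neutral_right) (auto simp: \<nu>_def Ms_def)
    also have "\<dots> = 0" using sum0 by (simp add: \<nu>_def)
    finally have "c0 *s q + (\<Sum>j\<in>S. c j *s axis j 1) = 0" by (simp add: sum_Ms c0 c)
    moreover have "(c0 *s q + (\<Sum>j\<in>S. c j *s axis j 1)) $ i = c0 + c i" if "i \<in> S" for i
      using that by (simp add: q_def axis_def if_distrib cong: if_cong)
    \<comment> \<open>Entry \<open>i\<close> of the relation ties every \<open>c i\<close> to
      \<open>c0\<close>, so one vanishing coefficient forces all of them to vanish.\<close>
    ultimately have rel: "c0 + c i = 0" if "i \<in> S" for i
      using that by (metis zero_index)
    obtain M where M: "M \<in> Ms" "M \<notin> Ns" using Ns by blast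
    then have "\<nu> M = 0" by (simp add: \<nu>_def)
    have "c0 = 0"
    proof (cases "M = V")
      case True
      then have "c0 *s q = 0" using c0 \<open>\<nu> M = 0\<close> by metis
      then have comp: "(c0 *s q) $ i = 0" for i by (simp only: zero_index)
      obtain i where "i \<in> S" using \<open>S \<noteq> {}\<close> by blast
      with comp [of i] show ?thesis by (simp add: q_def)
    next
      case False
      then obtain j where j: "j \<in> S" "M = U j" using M by (auto simp: Ms_def)
      then have "(c j *s axis j (1::int)) $ j = 0" using c [of j] \<open>\<nu> M = 0\<close> by simp
      then show ?thesis using rel [OF j(1)] by simp
    qed
    then have "\<nu> M = 0" if "M \<in> Ms" for M
      using that rel c0 c by (auto simp: Ms_def)
    then show ?thesis using Ns by (metis \<nu>_def psubsetD)
  qed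
  show ?thesis
  proof (rule that [of Ms \<kappa>])
    show "finite Ms" by (simp add: Ms_def)
    show "card Ms = s"
      using notin S assms finS by (simp add: Ms_def card_image inj_on_subset [OF inj])
    show "unipotent_matrix M" "M *v \<kappa> M = \<kappa> M" if "M \<in> Ms" for M
      using that U(1,2) V(1,2) matrix_vector_mult_diff_distrib [of V 0 q]
      by (auto simp: Ms_def \<kappa>)
    have "q \<noteq> 0" using \<open>S \<noteq> {}\<close> by (auto simp: q_def vec_eq_iff)
    moreover have "axis j 1 \<noteq> (0 :: int ^ 'n)" for j by (simp add: axis_eq_0_iff)
    ultimately show "\<kappa> M \<noteq> 0" if "M \<in> Ms" for M
      using that by (auto simp: Ms_def \<kappa>)
    show "(\<Sum>M\<in>Ms. \<kappa> M) = 0" by (simp add: sum_Ms \<kappa> q_sum)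
  qed (rule indep)
qed

section \<open>Approximation by trigonometric polynomials\<close>

text \<open>The linear span of the characters, presented inductively: a statement that is linear in
  the function has to be verified for characters only.\<close>

inductive trig_poly :: "('n::finite torus \<Rightarrow> complex) \<Rightarrow> bool" where
  char: "trig_poly (torus_char k)"
| add: "trig_poly f \<Longrightarrow> trig_poly g \<Longrightarrow> trig_poly (\<lambda>x. f x + g x)"
| scale: "trig_poly f \<Longrightarrow> trig_poly (\<lambda>x. c * f x)"

lemma trig_poly_const: "trig_poly (\<lambda>x. c)"
  using trig_poly.scale [OF trig_poly.char [of 0], of c] by simp

lemma trig_poly_sum: "(\<And>a. a \<in> A \<Longrightarrow> trig_poly (f a)) \<Longrightarrow> trig_poly (\<lambda>x. \<Sum>a\<in>A. f a x)"
  by (induction A rule: infinite_finite_induct) (simp_all add: trig_poly_const trig_poly.add)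

lemma trig_poly_mult: "trig_poly f \<Longrightarrow> trig_poly g \<Longrightarrow> trig_poly (\<lambda>x. f x * g x)"
proof (induction f rule: trig_poly.induct)
  case (char k)
  then show ?case
  proof (induction g rule: trig_poly.induct)
    case (char l)
    have "trig_poly (torus_char (k + l))" by (rule trig_poly.char)
    then show ?case by (simp add: torus_char_add [abs_def])
  next
    case (add f g)
    then show ?case by (simp add: distrib_left trig_poly.add)
  next
    case (scale f c)
    from trig_poly.scale [OF scale.IH, of c] show ?case by (simp add: mult_ac)
  qed
next
  case (add f1 f2)
  then show ?case by (simp add: distrib_right trig_poly.add)
next
  case (scale f c)
  from trig_poly.scale [OF scale.IH [OF scale.prems], of c] show ?case by (simp add: mult_ac)
qed

lemma measurable_trig_poly [measurable_dest]: "trig_poly f \<Longrightarrow> f \<in> borel_measurable borel"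
  by (induction rule: trig_poly.induct)
     (auto intro!: measurable_torus_char borel_measurable_add borel_measurable_times)

lemma bounded_trig_poly: "trig_poly f \<Longrightarrow> \<exists>C. \<forall>x. norm (f x) \<le> C"
proof (induction rule: trig_poly.induct)
  case (char k)
  show ?case by (intro exI [of _ 1]) simp
next
  case (add f g)
  then show ?case by (meson norm_triangle_mono)
next
  case (scale f c)
  then show ?case by (metis mult_left_mono norm_ge_zero norm_mult)
qed

lemma integrable_trig_poly:
  assumes "finite_measure M" "sets M = sets borel" "trig_poly f"
  shows "integrable M f"
proof -
  obtain C where "\<And>x. norm (f x) \<le> C" using bounded_trig_poly [OF assms(3)] by blast
  then show ?thesis
    using measurable_trig_poly [OF assms(3)] assms(1,2)
    by (intro finite_measure.integrable_const_bound [of _ _ C])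
       (auto cong: measurable_cong_sets)
qed

text \<open>The torus as a product of unit circles. Its image is a compact subset of a Euclidean
  space, where measures are regular and continuous functions can be approximated by
  polynomials.\<close>

definition char_embed :: "'n::finite torus \<Rightarrow> complex ^ 'n" where
  "char_embed x = (\<chi> i. torus_char (axis i 1) x)"

lemma continuous_on_char_embed: "continuous_on UNIV char_embed"
  unfolding char_embed_def by (intro continuous_intros continuous_on_torus_char)

lemma measurable_char_embed [measurable]: "char_embed \<in> borel_measurable borel"
  by (rule borel_measurable_continuous_onI [OF continuous_on_char_embed])

lemma inj_char_embed: "inj char_embed"
proof (rule injI)
  fix x y :: "'n::finite torus"
  assume eq: "char_embed x = char_embed y"
  obtain a b where ab: "x = torus_proj a" "y = torus_proj b" by (metis torus_proj_cases)
  have "a $ i - b $ i \<in> \<int>" for i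
  proof -
    have "torus_char (axis i 1) x = torus_char (axis i 1) y"
      using eq by (simp add: char_embed_def vec_eq_iff)
    then have "cis (2 * pi * a $ i) = cis (2 * pi * b $ i)"
      unfolding ab torus_char_proj
      by (simp add: axis_def if_distrib if_distribR cong: if_cong)
    then obtain n :: int where "2 * pi * a $ i = 2 * pi * b $ i + 2 * pi * n"
      unfolding complex_eq_iff cis.simps using sin_cos_eq_iff by metis
    then have "2 * pi * (a $ i - b $ i) = 2 * pi * n" by (simp add: algebra_simps)
    then show ?thesis by simp
  qed
  then show "x = y" by (simp add: ab torus_proj_eq_iff)
qed

lemma compact_UNIV_torus: "compact (UNIV :: 'n::finite torus set)"
proof -
  have "\<exists>y\<in>cbox 0 1. x = torus_proj y" for x :: "'n torus"
  proof -
    obtain a where a: "x = torus_proj a" by (rule torus_proj_cases)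
    have "torus_proj a = torus_proj (\<chi> i. frac (a $ i))"
      by (simp add: torus_proj_eq_iff frac_def)
    moreover have "(\<chi> i. frac (a $ i)) \<in> cbox 0 1"
      by (simp add: mem_box_cart frac_lt_1 less_imp_le)
    ultimately show ?thesis using a by blast
  qed
  then have "(UNIV :: 'n torus set) = torus_proj ` cbox 0 1" by blast
  moreover have "compact (torus_proj ` cbox 0 (1 :: real ^ 'n))"
    by (intro compact_continuous_image continuous_on_subset [OF continuous_on_torus_proj]) auto
  ultimately show ?thesis by simp
qed

text \<open>By compactness \<open>char_embed\<close> maps closed sets to closed sets, so by
  injectivity open sets are preimages of open sets. Preimages respect complements and countable
  unions.\<close>

lemma borel_torus_eq_vimage:
  assumes "A \<in> sets (borel :: 'n::finite torus measure)"
  obtains C where "C \<in> sets borel" "A = char_embed -` C"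
proof -
  have "A \<in> sigma_sets UNIV {U. open U}" using assms by (simp add: borel_def)
  then have "\<exists>C\<in>sets borel. A = char_embed -` C"
  proof (induction rule: sigma_sets.induct)
    case (Basic U)
    have "compact (UNIV \<inter> - U)" using Basic by (intro compact_Int_closed compact_UNIV_torus) auto
    then have "compact (char_embed ` (- U))"
      by (intro compact_continuous_image continuous_on_subset [OF continuous_on_char_embed]) auto
    then have "closed (char_embed ` (- U))" by (rule compact_imp_closed)
    then have "- (char_embed ` (- U)) \<in> sets borel" by (intro borel_open open_Compl)
    moreover have "U = char_embed -` (- (char_embed ` (- U)))"
      using inj_char_embed by (auto dest: injD)
    ultimately show ?case by blast
  next
    case Empty
    show ?case by (intro bexI [of _ "{}"]) auto
  next
    case (Compl A)
    then obtain C where "C \<in> sets borel" "A = char_embed -` C" by blast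
    then show ?case by (intro bexI [of _ "- C"]) auto
  next
    case (Union A)
    then obtain C where "\<And>i::nat. C i \<in> sets borel" "\<And>i. A i = char_embed -` C i" by metis
    then show ?case by (intro bexI [of _ "\<Union>i. C i"]) auto
  qed
  then show ?thesis using that by blast
qed

text \<open>Real coordinates of \<open>char_embed\<close> are cosines and sines, that is,
  combinations of a character and its conjugate, the character of the negated index. Products of
  trigonometric polynomials are trigonometric polynomials again.\<close>

lemma trig_poly_real_polynomial:
  fixes p :: "complex ^ 'n::finite \<Rightarrow> real"
  assumes "real_polynomial_function p"
  shows "trig_poly (\<lambda>x. complex_of_real (p (char_embed x)))"
  using assms
proof (induction rule: real_polynomial_function.induct)
  case (linear f)
  have "trig_poly (\<lambda>x :: 'n torus. complex_of_real (char_embed x \<bullet> b))" if bB: "b \<in> Basis" for b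
  proof -
    obtain i u where u: "u \<in> Basis" and b: "b = axis i u"
      using bB unfolding Basis_vec_def by blast
    define k :: "int ^ 'n" where "k = axis i 1"
    have eq: "char_embed x \<bullet> b = torus_char k x \<bullet> u" for x
      by (simp add: b inner_axis char_embed_def k_def)
    from u consider "u = 1" | "u = \<i>" by (auto simp: Basis_complex_def)
    then show ?thesis
    proof cases
      case 1
      have "complex_of_real (char_embed x \<bullet> b) = 1/2 * torus_char k x + 1/2 * torus_char (- k) x" for x
        by (simp add: eq 1 torus_char_uminus complex_eq_iff)
      then show ?thesis by (simp only: trig_poly.intros)
    next
      case 2
      have "complex_of_real (char_embed x \<bullet> b) = - \<i>/2 * torus_char k x + \<i>/2 * torus_char (- k) x" for x
        by (simp add: eq 2 torus_char_uminus complex_eq_iff)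
      then show ?thesis by (simp only: trig_poly.intros)
    qed
  qed
  then have trig: "trig_poly (\<lambda>x. \<Sum>b\<in>Basis. complex_of_real (f b) * complex_of_real (char_embed x \<bullet> b))"
    by (intro trig_poly_sum trig_poly.scale)
  have eq: "complex_of_real (f (char_embed x)) =
      (\<Sum>b\<in>Basis. complex_of_real (f b) * complex_of_real (char_embed x \<bullet> b))" for x
  proof -
    have "f (char_embed x) = f (\<Sum>b\<in>Basis. (char_embed x \<bullet> b) *\<^sub>R b)"
      by (simp only: euclidean_representation)
    also have "\<dots> = (\<Sum>b\<in>Basis. f b * (char_embed x \<bullet> b))"
      using bounded_linear.linear [OF linear] by (simp add: linear_sum linear_cmul mult.commute)
    finally show ?thesis by (simp only: of_real_sum of_real_mult)
  qed
  show ?case unfolding eq by (rule trig)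
qed (simp_all add: trig_poly_const trig_poly.add trig_poly_mult)

text \<open>Two measures are approximated at once: with \<open>\<mu> = \<nu>\<close> this is \<open>L\<^sup>1\<close>-density, and with
  \<open>\<nu>\<close> an image of \<open>\<mu>\<close> it shows that a finite measure on the torus is determined by its Fourier
  coefficients.\<close>

lemma borel_approx_continuous:
  fixes \<mu> \<nu> :: "'a::euclidean_space measure"
  assumes \<mu>: "finite_measure \<mu>" "sets \<mu> = sets borel" and \<nu>: "finite_measure \<nu>" "sets \<nu> = sets borel"
    and C: "C \<in> sets borel" and e: "(e::real) > 0"
  obtains g where "continuous_on UNIV g" "\<And>x. 0 \<le> g x \<and> g x \<le> (1::real)"
    "\<And>\<rho>. \<rho> \<in> {\<mu>, \<nu>} \<Longrightarrow> (\<integral>x. \<bar>indicator C x - g x\<bar> \<partial>\<rho>) < e"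
proof -
  have regular: "\<exists>K U. compact K \<and> K \<subseteq> C \<and> C \<subseteq> U \<and> open U \<and> measure \<rho> (U - K) < e"
    if \<rho>: "finite_measure \<rho>" "sets \<rho> = sets borel" for \<rho> :: "'a measure"
  proof -
    interpret finite_measure \<rho> by fact
    obtain K where K: "K \<subseteq> C" "compact K" "measure \<rho> C - e / 2 < measure \<rho> K"
    \<comment> \<open>A null set is approximated from inside by the empty set. Otherwise the
      positive measure makes the inequality strict in \<open>ennreal\<close>, where negative numbers
      are truncated to 0.\<close>
    proof (cases "measure \<rho> C = 0")
      case True
      then show ?thesis using that [of "{}"] e by simp
    next
      case False
      then have "ennreal (measure \<rho> C - e / 2) < ennreal (measure \<rho> C)"
        using e by (intro ennreal_lessI) (auto simp: zero_less_measure_iff)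
      also have "ennreal (measure \<rho> C) = (SUP K\<in>{K. K \<subseteq> C \<and> compact K}. emeasure \<rho> K)"
        using inner_regular [OF \<rho>(2) _ C] by (simp add: emeasure_eq_measure)
      finally obtain K where K: "K \<subseteq> C" "compact K" "ennreal (measure \<rho> C - e / 2) < ennreal (measure \<rho> K)"
        by (auto simp: less_SUP_iff emeasure_eq_measure)
      then show ?thesis using that ennreal_leI linorder_not_le by metis
    qed
    have "(INF U\<in>{U. C \<subseteq> U \<and> open U}. emeasure \<rho> U) = ennreal (measure \<rho> C)"
      using outer_regular [OF \<rho>(2) _ C] by (simp add: emeasure_eq_measure)
    also have "\<dots> < ennreal (measure \<rho> C + e / 2)"
      using e by (intro ennreal_lessI) (auto intro: add_nonneg_pos)
    finally obtain U where U: "C \<subseteq> U" "open U" "ennreal (measure \<rho> U) < ennreal (measure \<rho> C + e / 2)"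
      by (auto simp: INF_less_iff emeasure_eq_measure)
    then have "measure \<rho> U < measure \<rho> C + e / 2" using ennreal_leI linorder_not_le by metis
    moreover have "measure \<rho> (U - K) = measure \<rho> U - measure \<rho> K"
      using U K \<rho>(2) by (intro finite_measure_Diff) (auto simp: compact_imp_closed)
    ultimately have "measure \<rho> (U - K) < e" using K(3) by simp
    with U K show ?thesis by blast
  qed
  obtain K1 U1 where 1: "compact K1" "K1 \<subseteq> C" "C \<subseteq> U1" "open U1" "measure \<mu> (U1 - K1) < e"
    using regular [OF \<mu>] by blast
  obtain K2 U2 where 2: "compact K2" "K2 \<subseteq> C" "C \<subseteq> U2" "open U2" "measure \<nu> (U2 - K2) < e"
    using regular [OF \<nu>] by blast
  \<comment> \<open>One pair for both measures: \<open>U - K\<close> is contained in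
    \<open>U1 - K1\<close> and in \<open>U2 - K2\<close>, and the Urysohn function differs from the
    indicator only on \<open>U - K\<close>.\<close>
  define K U where "K = K1 \<union> K2" and "U = U1 \<inter> U2"
  have KU: "closed K" "open U" "K \<subseteq> C" "C \<subseteq> U"
    using 1 2 by (auto simp: K_def U_def compact_imp_closed)
  obtain g :: "'a \<Rightarrow> real" where g: "continuous_on UNIV g" "\<And>x. g x \<in> closed_segment 1 0"
    "\<And>x. x \<in> K \<Longrightarrow> g x = 1" "\<And>x. x \<in> - U \<Longrightarrow> g x = 0"
    using Urysohn [of K "- U" 1 "0::real"] KU by blast
  have g01: "0 \<le> g x \<and> g x \<le> 1" for x
    using g(2) [of x] by (simp add: closed_segment_eq_real_ivl)
  have [measurable]: "g \<in> borel_measurable borel" by (rule borel_measurable_continuous_onI [OF g(1)])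
  have [measurable]: "U \<in> sets borel" "K \<in> sets borel" "C \<in> sets borel" using KU C by auto
  have le: "\<bar>indicator C x - g x\<bar> \<le> indicator (U - K) x" for x
    using g01 [of x] g(3) [of x] g(4) [of x] KU by (auto simp: indicator_def)
  have le1: "norm \<bar>indicator C x - g x\<bar> \<le> 1" for x
    using g01 [of x] by (simp add: indicator_def abs_le_iff)
  have less: "(\<integral>x. \<bar>indicator C x - g x\<bar> \<partial>\<rho>) < e"
    if "finite_measure \<rho>" and [measurable_cong]: "sets \<rho> = sets borel" and "measure \<rho> (U - K) < e" for \<rho>
  proof -
    interpret finite_measure \<rho> by fact
    have sp: "space \<rho> = UNIV" using sets_eq_imp_space_eq [OF that(2)] by simp
    have "(\<integral>x. \<bar>indicator C x - g x\<bar> \<partial>\<rho>) \<le> (\<integral>x. indicator (U - K) x \<partial>\<rho>)"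
    proof (rule integral_mono)
      show "integrable \<rho> (\<lambda>x. \<bar>indicator C x - g x\<bar>)"
        by (rule integrable_const_bound [of _ 1], rule AE_I2, rule le1) measurable
      show "integrable \<rho> (indicator (U - K) :: 'a \<Rightarrow> real)"
        by (rule integrable_const_bound [of _ 1]) auto
    qed (rule le)
    also have "\<dots> = measure \<rho> (U - K)" by (simp add: sp)
    finally show ?thesis using that(3) by simp
  qed
  have "measure \<mu> (U - K) \<le> measure \<mu> (U1 - K1)" "measure \<nu> (U - K) \<le> measure \<nu> (U2 - K2)"
    using 1 2 \<mu>(2) \<nu>(2)
    by (auto intro!: finite_measure.finite_measure_mono [OF \<mu>(1)] finite_measure.finite_measure_mono [OF \<nu>(1)]
        simp: U_def K_def compact_imp_closed)
  then have "measure \<mu> (U - K) < e" "measure \<nu> (U - K) < e" using 1(5) 2(5) by simp_all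
  note less_e = less [OF \<mu> this(1)] less [OF \<nu> this(2)]
  show ?thesis
  proof (rule that [OF g(1) g01])
    fix \<rho> assume "\<rho> \<in> {\<mu>, \<nu>}"
    then consider "\<rho> = \<mu>" | "\<rho> = \<nu>" by blast
    then show "(\<integral>x. \<bar>indicator C x - g x\<bar> \<partial>\<rho>) < e"
      by cases (simp_all only: less_e)
  qed
qed

text \<open>Half of the error comes from a continuous function for the image measures under
  \<open>char_embed\<close>, the other half from a polynomial that is uniformly close to it on the
  compact image.\<close>

lemma borel_approx_trig_poly:
  fixes \<mu> \<nu> :: "'n::finite torus measure"
  assumes \<mu>: "finite_measure \<mu>" "sets \<mu> = sets borel" and \<nu>: "finite_measure \<nu>" "sets \<nu> = sets borel"
    and A: "A \<in> sets borel" and e: "(e::real) > 0"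
  obtains g where "trig_poly g"
    "\<And>\<rho>. \<rho> \<in> {\<mu>, \<nu>} \<Longrightarrow> (\<integral>x. norm (indicator A x - g x) \<partial>\<rho>) < e"
proof -
  obtain C where C: "C \<in> sets borel" "A = char_embed -` C" using borel_torus_eq_vimage [OF A] .
  have meas: "char_embed \<in> measurable \<rho> borel" if "sets \<rho> = sets borel" for \<rho> :: "'n torus measure"
    using measurable_char_embed measurable_cong_sets [OF that refl] by blast
  have fin: "finite_measure (distr \<rho> borel char_embed)"
    if "finite_measure \<rho>" "sets \<rho> = sets borel" for \<rho> :: "'n torus measure"
    by (rule finite_measure.finite_measure_distr [OF that(1) meas [OF that(2)]])
  obtain h where h: "continuous_on UNIV h" "\<And>x. 0 \<le> h x \<and> h x \<le> (1::real)"
    "\<And>\<rho>. \<rho> \<in> {distr \<mu> borel char_embed, distr \<nu> borel char_embed}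
        \<Longrightarrow> (\<integral>x. \<bar>indicator C x - h x\<bar> \<partial>\<rho>) < e / 2"
    by (rule borel_approx_continuous [OF fin [OF \<mu>] sets_distr fin [OF \<nu>] sets_distr C(1), of "e / 2"])
       (use e in auto)
  \<comment> \<open>Exceeds both total masses, so a uniform error of \<open>e / (2 * m)\<close>
    integrates to at most \<open>e / 2\<close>.\<close>
  define m where "m = measure \<mu> UNIV + measure \<nu> UNIV + 1"
  have m: "m > 0" "measure \<mu> UNIV < m" "measure \<nu> UNIV < m"
    by (auto simp: m_def add_nonneg_pos add_pos_nonneg  measure_nonneg intro: add_strict_increasing2 add_nonneg_pos)
  have "compact (range (char_embed :: 'n torus \<Rightarrow> _))"
    by (intro compact_continuous_image continuous_on_char_embed compact_UNIV_torus)
  then obtain p where p: "real_polynomial_function p"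
    "\<And>x. x \<in> range (char_embed :: 'n torus \<Rightarrow> _) \<Longrightarrow> \<bar>h x - p x\<bar> < e / (2 * m)"
    by (rule Stone_Weierstrass_real_polynomial_function [of _ h "e / (2 * m)"])
       (use continuous_on_subset [OF h(1)] e m in auto)
  define g where "g x = complex_of_real (p (char_embed x))" for x :: "'n torus"
  have g: "trig_poly g" unfolding g_def by (rule trig_poly_real_polynomial [OF p(1)])
  have [measurable]: "h \<in> borel_measurable borel" by (rule borel_measurable_continuous_onI [OF h(1)])
  have less: "(\<integral>x. norm (indicator A x - g x) \<partial>\<rho>) < e"
    if \<rho>: "finite_measure \<rho>" and S [measurable_cong]: "sets \<rho> = sets borel"
      and "(\<integral>x. \<bar>indicator C x - h x\<bar> \<partial>distr \<rho> borel char_embed) < e / 2" "measure \<rho> UNIV < m"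
    for \<rho> :: "'n torus measure"
  proof -
    interpret finite_measure \<rho> by fact
    have sp: "space \<rho> = UNIV" using sets_eq_imp_space_eq [OF S] by simp
    have [measurable]: "A \<in> sets borel" "C \<in> sets borel" by fact+
    have [measurable]: "g \<in> borel_measurable borel" using g by measurable
    have int: "integrable \<rho> (\<lambda>x. \<bar>indicator C (char_embed x) - h (char_embed x)\<bar>)"
    proof (rule integrable_const_bound [of _ 1], rule AE_I2)
      fix x
      show "norm \<bar>indicator C (char_embed x) - h (char_embed x)\<bar> \<le> 1"
        using h(2) [of "char_embed x"] by (simp add: indicator_def abs_le_iff)
    qed measurable
    have "(\<integral>x. norm (indicator A x - g x) \<partial>\<rho>)
        \<le> (\<integral>x. \<bar>indicator C (char_embed x) - h (char_embed x)\<bar> + e / (2 * m) \<partial>\<rho>)"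
    proof (rule integral_mono)
      show "integrable \<rho> (\<lambda>x. norm (indicator A x - g x))"
        by (intro integrable_norm Bochner_Integration.integrable_diff integrable_trig_poly [OF \<rho> S g]
            integrable_const_bound [of _ 1]) (auto simp: indicator_def)
      show "integrable \<rho> (\<lambda>x. \<bar>indicator C (char_embed x) - h (char_embed x)\<bar> + e / (2 * m))"
        by (intro Bochner_Integration.integrable_add int) simp
      fix x
      have "indicator A x - g x = complex_of_real (indicator C (char_embed x) - p (char_embed x))"
        by (simp add: g_def C(2) indicator_def)
      then have "norm (indicator A x - g x) = \<bar>indicator C (char_embed x) - p (char_embed x)\<bar>"
        by (simp only: norm_of_real)
      then show "norm (indicator A x - g x) \<le> \<bar>indicator C (char_embed x) - h (char_embed x)\<bar> + e / (2 * m)"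
        using p(2) [of "char_embed x"] by force
    qed
    also have "\<dots> = (\<integral>x. \<bar>indicator C (char_embed x) - h (char_embed x)\<bar> \<partial>\<rho>) + measure \<rho> UNIV * (e / (2 * m))"
      using int by (simp add: sp)
    also have "(\<integral>x. \<bar>indicator C (char_embed x) - h (char_embed x)\<bar> \<partial>\<rho>)
        = (\<integral>x. \<bar>indicator C x - h x\<bar> \<partial>distr \<rho> borel char_embed)"
      by (rule integral_distr [symmetric]) measurable
    also have "\<dots> < e / 2" by fact
    also have "measure \<rho> UNIV * (e / (2 * m)) \<le> m * (e / (2 * m))"
      using that(4) e m by (intro mult_right_mono) auto
    also have "\<dots> = e / 2" using m by simp
    finally show ?thesis by simp
  qed
  note less_e = less [OF \<mu> h(3) [OF insertI1] m(2)] less [OF \<nu> h(3) [OF insertI2 [OF singletonI]] m(3)]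
  show ?thesis
  proof (rule that [OF g])
    fix \<rho> assume "\<rho> \<in> {\<mu>, \<nu>}"
    then consider "\<rho> = \<mu>" | "\<rho> = \<nu>" by blast
    then show "(\<integral>x. norm (indicator A x - g x) \<partial>\<rho>) < e"
      by cases (simp_all only: less_e)
  qed
qed

section \<open>A mixing criterion\<close>

text \<open>Uniqueness of Fourier coefficients. Both measures integrate a trigonometric polynomial
  to the same value, and one polynomial is L1-close to the indicator for both measures. With
  \<open>e\<close> half of a supposed gap, the gap would be less than \<open>e + e\<close>.\<close>

lemma distr_haar_borel_eqI:
  fixes T :: "'n::finite torus \<Rightarrow> 'n torus"
  assumes T [measurable]: "T \<in> borel_measurable borel"
    and char: "\<And>k. (\<integral>x. torus_char k (T x) \<partial>haar_borel) = integral\<^sup>L haar_borel (torus_char k)"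
  shows "distr haar_borel borel T = haar_borel"
proof (rule measure_eqI)
  let ?\<nu> = "distr haar_borel borel T"
  have T' [measurable]: "T \<in> measurable haar_borel borel" by measurable
  have fin: "finite_measure ?\<nu>"
    by (rule finite_measure.finite_measure_distr [OF finite_measure_haar_borel T'])
  fix A assume "A \<in> sets ?\<nu>"
  then have A [measurable]: "A \<in> sets borel" by simp
  have trig: "integral\<^sup>L ?\<nu> g = integral\<^sup>L haar_borel g" if "trig_poly g" for g
    using that
  proof (induction rule: trig_poly.induct)
    case (char k)
    show ?case by (simp add: integral_distr assms(2))
  next
    case (add f g)
    then show ?case
      by (simp add: integrable_trig_poly [OF fin] integrable_trig_poly [OF finite_measure_haar_borel])
  next
    case (scale f c)
    then show ?case by simp
  qed
  have diff: "norm (complex_of_real (measure \<rho> A) - integral\<^sup>L \<rho> g) \<le> (\<integral>x. norm (indicator A x - g x) \<partial>\<rho>)"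
    if "finite_measure \<rho>" "sets \<rho> = sets borel" "trig_poly g" for \<rho> g
  proof -
    interpret finite_measure \<rho> by fact
    have "integrable \<rho> (indicator A :: _ \<Rightarrow> complex)"
      using A that(2) by (intro integrable_const_bound [of _ 1]) (auto simp: indicator_def)
    moreover have "space \<rho> = UNIV" using sets_eq_imp_space_eq [OF that(2)] by simp
    moreover have "integral\<^sup>L \<rho> (indicator A :: _ \<Rightarrow> complex) = of_real (measure \<rho> A)"
      using integral_complex_of_real [of \<rho> "indicator A"] A that(2) calculation(2)
      by (simp add: of_real_indicator)
    ultimately have "complex_of_real (measure \<rho> A) - integral\<^sup>L \<rho> g = (\<integral>x. indicator A x - g x \<partial>\<rho>)"
      using integrable_trig_poly [OF that] by simp
    then show ?thesis by (simp add: integral_norm_bound)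
  qed
  have "measure ?\<nu> A = measure haar_borel A"
  proof (rule ccontr)
    assume neq: "measure ?\<nu> A \<noteq> measure haar_borel A"
    define e where "e = \<bar>measure ?\<nu> A - measure haar_borel A\<bar> / 2"
    have "e > 0" using neq by (simp add: e_def)
    obtain g where g: "trig_poly g"
      "\<And>\<rho>. \<rho> \<in> {?\<nu>, haar_borel} \<Longrightarrow> (\<integral>x. norm (indicator A x - g x) \<partial>\<rho>) < e"
      by (rule borel_approx_trig_poly [OF fin sets_distr finite_measure_haar_borel sets_haar_borel A
            \<open>e > 0\<close>]) (rule that)
    have "norm (complex_of_real (measure ?\<nu> A) - integral\<^sup>L haar_borel g) < e"
      using diff [OF fin sets_distr g(1)] g(2) [of ?\<nu>] trig [OF g(1)] by simp
    moreover have "norm (complex_of_real (measure haar_borel A) - integral\<^sup>L haar_borel g) < e"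
      using diff [OF finite_measure_haar_borel sets_haar_borel g(1)] g(2) [of haar_borel] by simp
    ultimately have "norm (complex_of_real (measure ?\<nu> A) - complex_of_real (measure haar_borel A)) < e + e"
      by (rule norm_diff_triangle_less [OF _ norm_minus_commute [THEN ord_eq_less_trans]])
    then show False by (simp add: e_def flip: of_real_diff)
  qed
  then show "emeasure ?\<nu> A = emeasure haar_borel A"
    by (simp add: finite_measure.emeasure_eq_measure [OF fin]
        finite_measure.emeasure_eq_measure [OF finite_measure_haar_borel])
qed simp

lemma integrable_haar_borel_bounded:
  fixes f :: "'n::finite torus \<Rightarrow> complex"
  assumes "f \<in> borel_measurable borel" "\<And>x. norm (f x) \<le> C"
  shows "integrable haar_borel f"
  using assms by (intro finite_measure.integrable_const_bound [OF finite_measure_haar_borel, of _ C]) auto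

lemma integral_indicator_haar_borel:
  "A \<in> sets borel \<Longrightarrow> integral\<^sup>L haar_borel (indicator A) = complex_of_real (measure haar_borel A)"
  using integral_complex_of_real [of haar_borel "indicator A"] by (simp add: of_real_indicator)

text \<open>Replaces one character by an indicator. \<open>W n\<close> stands for the product of the
  other factors, \<open>c\<close> for the product of their integrals. Since \<open>T n\<close>
  preserves the measure and \<open>W n\<close> is bounded by 1, the approximation error does not
  depend on n.\<close>

lemma tendsto_integral_indicator:
  fixes W :: "nat \<Rightarrow> 'n::finite torus \<Rightarrow> complex"
  assumes W [measurable]: "\<And>n. W n \<in> borel_measurable borel" and W1: "\<And>n x. norm (W n x) \<le> 1"
    and T [measurable]: "\<And>n. T n \<in> borel_measurable borel"
    and pres: "\<And>n. distr haar_borel borel (T n) = haar_borel"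
    and c: "norm c \<le> 1" and A [measurable]: "A \<in> sets borel"
    and lim: "\<And>k. (\<lambda>n. \<integral>x. torus_char k (T n x) * W n x \<partial>haar_borel)
      \<longlonglongrightarrow> integral\<^sup>L haar_borel (torus_char k) * c"
  shows "(\<lambda>n. \<integral>x. indicator A (T n x) * W n x \<partial>haar_borel)
      \<longlonglongrightarrow> integral\<^sup>L haar_borel (indicator A) * c"
proof -
  have int: "integrable haar_borel (\<lambda>x. f (T n x) * W n x)"
    if f [measurable]: "f \<in> borel_measurable borel" and b: "\<And>x. norm (f x) \<le> C" for f C n
  proof (rule integrable_haar_borel_bounded)
    fix x
    have "norm (f (T n x) * W n x) \<le> C * 1"
      unfolding norm_mult by (rule mult_mono [OF b W1 order_trans [OF norm_ge_zero b] norm_ge_zero])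
    then show "norm (f (T n x) * W n x) \<le> C" by simp
  qed measurable
  have trig_int: "integrable haar_borel (\<lambda>x. g (T n x) * W n x)" if "trig_poly g" for g n
    using int measurable_trig_poly [OF that] bounded_trig_poly [OF that] by blast
  have trig: "(\<lambda>n. \<integral>x. g (T n x) * W n x \<partial>haar_borel) \<longlonglongrightarrow> integral\<^sup>L haar_borel g * c"
    if "trig_poly g" for g
    using that
  proof (induction rule: trig_poly.induct)
    case (char k)
    show ?case by (rule lim)
  next
    case (add f g)
    from tendsto_add [OF add.IH] show ?case
      using add.hyps by (simp add: distrib_right trig_int
          integrable_trig_poly [OF finite_measure_haar_borel])
  next
    case (scale f b)
    from tendsto_mult_left [OF scale.IH, of b] show ?case by (simp add: mult.assoc)
  qed
  have ind_int: "integrable haar_borel (indicator A :: _ \<Rightarrow> complex)"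
    by (rule integrable_haar_borel_bounded [of _ 1]) (auto simp: indicator_def)
  show ?thesis
  proof (rule LIMSEQ_I)
    fix e :: real assume "e > 0"
    then have "e / 3 > 0" by simp
    obtain g where g: "trig_poly g"
      "\<And>\<rho>. \<rho> \<in> {haar_borel, haar_borel} \<Longrightarrow> (\<integral>x. norm (indicator A x - g x) \<partial>\<rho>) < e / 3"
      by (rule borel_approx_trig_poly [OF finite_measure_haar_borel sets_haar_borel
            finite_measure_haar_borel sets_haar_borel A \<open>e / 3 > 0\<close>]) (rule that)
    have [measurable]: "g \<in> borel_measurable borel" by (rule measurable_trig_poly [OF g(1)])
    have g_int: "integrable haar_borel g"
      by (rule integrable_trig_poly [OF finite_measure_haar_borel sets_haar_borel g(1)])
    have d_int: "integrable haar_borel (\<lambda>x. norm (indicator A x - g x))"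
      using ind_int g_int by auto
    have near: "norm ((\<integral>x. indicator A (T n x) * W n x \<partial>haar_borel) - (\<integral>x. g (T n x) * W n x \<partial>haar_borel)) < e / 3" for n
    proof -
      have ind_W: "integrable haar_borel (\<lambda>x. indicator A (T n x) * W n x)"
        by (rule int [of _ 1]) (auto simp: indicator_def)
      have d_T: "integrable haar_borel (\<lambda>x. norm (indicator A (T n x) - g (T n x)))"
        by (subst integrable_distr_eq [of "T n" haar_borel borel "\<lambda>x. norm (indicator A x - g x)", symmetric])
           (simp_all add: pres d_int)
      have "norm ((\<integral>x. indicator A (T n x) * W n x \<partial>haar_borel) - (\<integral>x. g (T n x) * W n x \<partial>haar_borel))
          = norm (\<integral>x. (indicator A (T n x) - g (T n x)) * W n x \<partial>haar_borel)"
        using ind_W trig_int [OF g(1)] by (simp add: left_diff_distrib)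
      also have "\<dots> \<le> (\<integral>x. norm ((indicator A (T n x) - g (T n x)) * W n x) \<partial>haar_borel)"
        by (rule integral_norm_bound)
      also have "\<dots> \<le> (\<integral>x. norm (indicator A (T n x) - g (T n x)) \<partial>haar_borel)"
      proof (rule integral_mono [OF _ d_T])
        show "integrable haar_borel (\<lambda>x. norm ((indicator A (T n x) - g (T n x)) * W n x))"
          using ind_W trig_int [OF g(1)] by (simp add: left_diff_distrib)
        show "norm ((indicator A (T n x) - g (T n x)) * W n x) \<le> norm (indicator A (T n x) - g (T n x))" for x
          by (simp add: norm_mult mult_left_le W1)
      qed
      also have "\<dots> = (\<integral>x. norm (indicator A x - g x) \<partial>distr haar_borel borel (T n))"
        by (rule integral_distr [symmetric]) measurable
      also have "\<dots> < e / 3" using g(2) [of haar_borel] by (simp add: pres)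
      finally show ?thesis .
    qed
    have near': "norm (integral\<^sup>L haar_borel g * c - integral\<^sup>L haar_borel (indicator A) * c) < e / 3"
    proof -
      have "integral\<^sup>L haar_borel g * c - integral\<^sup>L haar_borel (indicator A) * c
          = - ((\<integral>x. indicator A x - g x \<partial>haar_borel) * c)"
        using ind_int g_int by (simp add: left_diff_distrib)
      then have "norm (integral\<^sup>L haar_borel g * c - integral\<^sup>L haar_borel (indicator A) * c)
          \<le> norm (\<integral>x. indicator A x - g x \<partial>haar_borel)"
        using c by (simp add: norm_mult mult_left_le)
      also have "\<dots> \<le> (\<integral>x. norm (indicator A x - g x) \<partial>haar_borel)" by (rule integral_norm_bound)
      finally show ?thesis using g(2) [of haar_borel] by simp
    qed
    obtain N where N: "\<And>n. n \<ge> N \<Longrightarrow>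
        norm ((\<integral>x. g (T n x) * W n x \<partial>haar_borel) - integral\<^sup>L haar_borel g * c) < e / 3"
      using LIMSEQ_D [OF trig [OF g(1)] \<open>e / 3 > 0\<close>] by blast
    have "norm ((\<integral>x. indicator A (T n x) * W n x \<partial>haar_borel) - integral\<^sup>L haar_borel (indicator A) * c) < e"
      if "n \<ge> N" for n
    proof -
      from norm_diff_triangle_less [OF norm_diff_triangle_less [OF near N [OF that]] near']
      show ?thesis by simp
    qed
    then show "\<exists>N. \<forall>n\<ge>N. norm ((\<integral>x. indicator A (T n x) * W n x \<partial>haar_borel)
        - integral\<^sup>L haar_borel (indicator A) * c) < e" by blast
  qed
qed

lemma norm_prod_le_one:
  fixes f :: "'i \<Rightarrow> complex"
  assumes "\<And>i. i \<in> I \<Longrightarrow> norm (f i) \<le> 1"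
  shows "norm (\<Prod>i\<in>I. f i) \<le> 1"
  unfolding prod_norm [symmetric] using assms by (intro prod_le_1) auto

text \<open>The characters are replaced by indicator functions one index at a time.\<close>

lemma tendsto_integral_prod_indicator:
  fixes T :: "'i \<Rightarrow> nat \<Rightarrow> 'n::finite torus \<Rightarrow> 'n torus"
  assumes "finite I" and T [measurable]: "\<And>i n. T i n \<in> borel_measurable borel"
    and pres: "\<And>i n. i \<in> I \<Longrightarrow> distr haar_borel borel (T i n) = haar_borel"
    and lim: "\<And>\<kappa>. (\<lambda>n. \<integral>x. (\<Prod>i\<in>I. torus_char (\<kappa> i) (T i n x)) \<partial>haar_borel)
      \<longlonglongrightarrow> (\<Prod>i\<in>I. integral\<^sup>L haar_borel (torus_char (\<kappa> i)))"
    and A: "\<And>i. i \<in> I \<Longrightarrow> A i \<in> sets borel"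
  shows "(\<lambda>n. \<integral>x. (\<Prod>i\<in>I. indicator (A i) (T i n x)) \<partial>haar_borel)
      \<longlonglongrightarrow> (\<Prod>i\<in>I. integral\<^sup>L haar_borel (indicator (A i)) :: complex)"
proof -
  have ind1: "norm (integral\<^sup>L haar_borel (indicator (A i)) :: complex) \<le> 1" if "i \<in> I" for i
  proof -
    have "measure haar_borel (A i) \<le> 1"
      using finite_measure.bounded_measure [OF finite_measure_haar_borel, of "A i"]
      by (simp add: measure_def)
    then show ?thesis using A [OF that] by (simp add: integral_indicator_haar_borel)
  qed
  have char1: "norm (integral\<^sup>L haar_borel (torus_char k)) \<le> 1" for k :: "int ^ 'n"
    by (simp add: integral_torus_char)
  have "(\<lambda>n. \<integral>x. (\<Prod>i\<in>J. indicator (A i) (T i n x)) * (\<Prod>i\<in>I - J. torus_char (\<kappa> i) (T i n x)) \<partial>haar_borel)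
      \<longlonglongrightarrow> (\<Prod>i\<in>J. integral\<^sup>L haar_borel (indicator (A i)))
        * (\<Prod>i\<in>I - J. integral\<^sup>L haar_borel (torus_char (\<kappa> i)))"
    if "J \<subseteq> I" for J \<kappa>
    using finite_subset [OF that \<open>finite I\<close>] that
  \<comment> \<open>The step at \<open>a\<close> needs the hypothesis with every possible character
    at index \<open>a\<close>, hence for modified \<open>\<kappa>\<close>.\<close>
  proof (induction J arbitrary: \<kappa>)
    case empty
    then show ?case using lim by simp
  next
    case (insert a J)
    define R where "R = I - insert a J"
    have IJ: "I - J = insert a R" "a \<notin> R" "finite R" "a \<in> I"
      using insert \<open>finite I\<close> by (auto simp: R_def)
    define W where "W n x = (\<Prod>i\<in>J. indicator (A i) (T i n x)) * (\<Prod>i\<in>R. torus_char (\<kappa> i) (T i n x))"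
      for n x
    define c where "c = (\<Prod>i\<in>J. integral\<^sup>L haar_borel (indicator (A i)))
        * (\<Prod>i\<in>R. integral\<^sup>L haar_borel (torus_char (\<kappa> i)))"
    have "(\<lambda>n. \<integral>x. indicator (A a) (T a n x) * W n x \<partial>haar_borel)
        \<longlonglongrightarrow> integral\<^sup>L haar_borel (indicator (A a)) * c"
    proof (rule tendsto_integral_indicator)
      have [measurable]: "A i \<in> sets borel" if "i \<in> J" for i using that insert.prems A by blast
      show "W n \<in> borel_measurable borel" for n
        unfolding W_def
        by (intro borel_measurable_times borel_measurable_prod) measurable
      show "norm (W n x) \<le> 1" for n x
        unfolding W_def norm_mult
        by (intro mult_le_one norm_prod_le_one) (auto simp: indicator_def)
      show "norm c \<le> 1"
        unfolding c_def norm_mult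
        by (intro mult_le_one norm_prod_le_one ind1 char1) (use insert.prems in auto)
      fix k
      have "(\<Prod>i\<in>R. torus_char ((\<kappa>(a := k)) i) (T i n x)) = (\<Prod>i\<in>R. torus_char (\<kappa> i) (T i n x))" for n x
        using IJ by (intro prod.cong) auto
      moreover have "(\<Prod>i\<in>R. integral\<^sup>L haar_borel (torus_char ((\<kappa>(a := k)) i)))
          = (\<Prod>i\<in>R. integral\<^sup>L haar_borel (torus_char (\<kappa> i)))"
        using IJ by (intro prod.cong) auto
      ultimately show "(\<lambda>n. \<integral>x. torus_char k (T a n x) * W n x \<partial>haar_borel)
          \<longlonglongrightarrow> integral\<^sup>L haar_borel (torus_char k) * c"
        using insert.IH [of "\<kappa>(a := k)"] insert.prems IJ
        by (simp add: W_def c_def mult.left_commute del: fun_upd_apply) simp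
    qed (use T pres A IJ in auto)
    then show ?case
      using insert.hyps by (simp add: W_def c_def R_def mult.assoc)
  qed
  from this [of I] show ?thesis by simp
qed

text \<open>Brings the limit relation from Borel sets to the completion, where an intersection of
  preimages is Borel only up to a null set.\<close>

lemma measure_completion_sandwich:
  assumes "X \<in> sets M" "Y \<in> null_sets M" "X \<subseteq> Z" "Z \<subseteq> X \<union> Y"
  shows "measure (completion M) Z = measure M X"
proof -
  have Z: "Z \<in> sets (completion M)"
    using assms by (intro sets_completionI [of _ X "Z - X" Y]) auto
  have XY: "X \<union> Y \<in> sets M" using assms by auto
  have "emeasure (completion M) Z \<le> emeasure (completion M) (X \<union> Y)"
    using assms XY by (intro emeasure_mono) auto
  also have "\<dots> = emeasure M (X \<union> Y)" using XY by simp
  also have "\<dots> = emeasure M X" using assms by (intro emeasure_Un_null_set)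
  finally have "emeasure (completion M) Z \<le> emeasure M X" .
  moreover have "emeasure (completion M) X \<le> emeasure (completion M) Z"
    using assms Z by (intro emeasure_mono)
  ultimately have "emeasure (completion M) Z = emeasure M X"
    using assms by (intro antisym) auto
  then show ?thesis by (simp add: measure_def)
qed

theorem mixing_set_torus_mapI:
  fixes Ms :: "(int ^ 'n::finite ^ 'n) set"
  assumes fin: "finite Ms"
    and rel: "\<And>\<kappa>. \<exists>M\<in>Ms. \<kappa> M \<noteq> 0 \<Longrightarrow> finite {n. (\<Sum>M\<in>Ms. ((*v) M ^^ n) (\<kappa> M)) = 0}"
  shows "mixing_set (torus_map ` Ms)"
proof -
  \<comment> \<open>Injectivity is hidden in \<open>rel\<close>: if an iterate killed
    \<open>k\<close>, so would all later ones, and the family supported at \<open>M\<close> alone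
    would satisfy the relation infinitely often. It makes the iterates preserve Haar
    measure.\<close>
  have inj: "((*v) M ^^ n) k \<noteq> 0" if M: "M \<in> Ms" and k: "k \<noteq> 0" for M n k
  proof
    assume n: "((*v) M ^^ n) k = 0"
    define \<kappa> where "\<kappa> N = (if N = M then k else 0)" for N
    have "((*v) M ^^ (m + n)) k = 0" for m by (simp add: funpow_add n)
    then have "((*v) M ^^ m) k = 0" if "m \<ge> n" for m
      using le_add_diff_inverse2 [OF that] by metis
    moreover have "(\<Sum>N\<in>Ms. ((*v) N ^^ m) (\<kappa> N)) = ((*v) M ^^ m) k" for m
    proof -
      have "(\<Sum>N\<in>Ms. ((*v) N ^^ m) (\<kappa> N)) = (\<Sum>N\<in>Ms. if N = M then ((*v) M ^^ m) k else 0)"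
        by (intro sum.cong) (auto simp: \<kappa>_def)
      then show ?thesis using M fin by simp
    qed
    ultimately have "{n..} \<subseteq> {m. (\<Sum>N\<in>Ms. ((*v) N ^^ m) (\<kappa> N)) = 0}" by auto
    moreover have "finite {m. (\<Sum>N\<in>Ms. ((*v) N ^^ m) (\<kappa> N)) = 0}"
      by (rule rel) (use M k in \<open>auto simp: \<kappa>_def\<close>)
    ultimately show False using finite_subset infinite_Ici by blast
  qed
  have pres: "distr haar_borel borel (torus_map M ^^ n) = haar_borel" if "M \<in> Ms" for M n
  proof (rule distr_haar_borel_eqI)
    fix k
    have "((*v) M ^^ n) k = 0 \<longleftrightarrow> k = 0" using inj [OF that] funpow_mult_vec_zero by metis
    then show "(\<integral>x. torus_char k ((torus_map M ^^ n) x) \<partial>haar_borel) = integral\<^sup>L haar_borel (torus_char k)"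
      by (simp add: torus_char_funpow_torus_map integral_torus_char)
  qed measurable
  have lim: "(\<lambda>n. \<integral>x. (\<Prod>M\<in>Ms. torus_char (\<kappa> M) ((torus_map M ^^ n) x)) \<partial>haar_borel)
      \<longlonglongrightarrow> (\<Prod>M\<in>Ms. integral\<^sup>L haar_borel (torus_char (\<kappa> M)))" for \<kappa>
  \<comment> \<open>The product of characters is a single character. If some vector is nonzero, its
    index is nonzero for all but finitely many n, so the integral vanishes, as does one factor on
    the right. Otherwise everything is 1.\<close>
  proof (cases "\<exists>M\<in>Ms. \<kappa> M \<noteq> 0")
    case True
    have "\<forall>\<^sub>F n in sequentially. (\<Sum>M\<in>Ms. ((*v) M ^^ n) (\<kappa> M)) \<noteq> 0"
      using rel [OF True] by (simp add: eventually_cofinite flip: cofinite_eq_sequentially)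
    then have "\<forall>\<^sub>F n in sequentially. (\<integral>x. (\<Prod>M\<in>Ms. torus_char (\<kappa> M) ((torus_map M ^^ n) x)) \<partial>haar_borel) = 0"
      by eventually_elim (simp add: torus_char_funpow_torus_map integral_torus_char flip: torus_char_sum)
    moreover have "(\<Prod>M\<in>Ms. integral\<^sup>L haar_borel (torus_char (\<kappa> M))) = 0"
      using True fin by (simp add: integral_torus_char)
    ultimately show ?thesis by (simp only: tendsto_eventually)
  next
    case False
    then have "(\<Prod>M\<in>Ms. torus_char (\<kappa> M) y) = 1" "(\<Prod>M\<in>Ms. integral\<^sup>L haar_borel (torus_char (\<kappa> M))) = 1"
      "(\<Prod>M\<in>Ms. torus_char (\<kappa> M) ((torus_map M ^^ n) x)) = 1" for y n x
      by (auto intro!: prod.neutral simp: integral_torus_char)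
    then show ?thesis by (simp add: measure_def)
  qed
  show ?thesis
    unfolding mixing_set_def
  proof (intro allI impI)
    fix B :: "('n torus \<Rightarrow> 'n torus) \<Rightarrow> 'n torus set"
    assume B: "\<forall>\<gamma>\<in>torus_map ` Ms. B \<gamma> \<in> sets torus_haar"
    have "\<exists>S N. S \<in> sets borel \<and> N \<in> null_sets haar_borel \<and> S \<subseteq> B (torus_map M) \<and> B (torus_map M) \<subseteq> S \<union> N"
      if "M \<in> Ms" for M
    proof -
      have "B (torus_map M) \<in> sets (completion haar_borel)"
        using B that by (simp add: torus_haar_eq)
      then show ?thesis by (rule sets_completionE) auto
    qed
    then obtain S N where SN: "\<And>M. M \<in> Ms \<Longrightarrow> S M \<in> sets borel"
      "\<And>M. M \<in> Ms \<Longrightarrow> N M \<in> null_sets haar_borel"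
      "\<And>M. M \<in> Ms \<Longrightarrow> S M \<subseteq> B (torus_map M)" "\<And>M. M \<in> Ms \<Longrightarrow> B (torus_map M) \<subseteq> S M \<union> N M"
      by metis
    have meas: "(torus_map M ^^ n) -` X \<in> sets borel" if "X \<in> sets borel" for M n and X :: "'n torus set"
      by (rule measurable_sets_borel [OF measurable_funpow_torus_map that])
    \<comment> \<open>Measure preservation keeps the exceptional sets null under all iterates, so
      each \<open>B \<gamma>\<close> can be replaced by a Borel set inside it.\<close>
    have null: "(torus_map M ^^ n) -` N M \<in> null_sets haar_borel" if "M \<in> Ms" for M n
    proof -
      have "N M \<in> null_sets (distr haar_borel borel (torus_map M ^^ n))"
        using SN(2) [OF that] by (simp add: pres [OF that])
      then show ?thesis by (subst (asm) null_sets_distr_iff) simp_all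
    qed
    have INT_sets: "(\<Inter>M\<in>Ms. (torus_map M ^^ n) -` S M) \<in> sets borel" for n
      using SN(1) meas fin by (cases "Ms = {}") (auto intro!: sets.finite_INT)
    have eq: "measure torus_haar (\<Inter>M\<in>Ms. (torus_map M ^^ n) -` B (torus_map M))
        = measure haar_borel (\<Inter>M\<in>Ms. (torus_map M ^^ n) -` S M)" for n
      unfolding torus_haar_eq
    proof (rule measure_completion_sandwich)
      show "(\<Inter>M\<in>Ms. (torus_map M ^^ n) -` S M) \<in> sets haar_borel"
        using INT_sets by simp
      show "(\<Union>M\<in>Ms. (torus_map M ^^ n) -` N M) \<in> null_sets haar_borel"
        using null fin by (intro null_sets.finite_UN)
      show "(\<Inter>M\<in>Ms. (torus_map M ^^ n) -` S M) \<subseteq> (\<Inter>M\<in>Ms. (torus_map M ^^ n) -` B (torus_map M))"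
        using SN(3) by blast
      show "(\<Inter>M\<in>Ms. (torus_map M ^^ n) -` B (torus_map M))
          \<subseteq> (\<Inter>M\<in>Ms. (torus_map M ^^ n) -` S M) \<union> (\<Union>M\<in>Ms. (torus_map M ^^ n) -` N M)"
        using SN(4) by blast
    qed
    have eq1: "measure torus_haar (B (torus_map M)) = measure haar_borel (S M)" if "M \<in> Ms" for M
      unfolding torus_haar_eq using SN(1) that
      by (intro measure_completion_sandwich [OF _ SN(2) SN(3) SN(4)]) auto
    have ind: "(\<Prod>M\<in>Ms. indicator (S M) ((torus_map M ^^ n) x))
        = (indicator (\<Inter>M\<in>Ms. (torus_map M ^^ n) -` S M) x :: complex)" for n x
      using fin by (auto simp: indicator_def prod_zero_iff intro!: prod.neutral)
    have "(\<lambda>n. \<integral>x. (\<Prod>M\<in>Ms. indicator (S M) ((torus_map M ^^ n) x)) \<partial>haar_borel)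
        \<longlonglongrightarrow> (\<Prod>M\<in>Ms. integral\<^sup>L haar_borel (indicator (S M)) :: complex)"
      by (rule tendsto_integral_prod_indicator) (use fin pres lim SN in auto)
    then have "(\<lambda>n. complex_of_real (measure haar_borel (\<Inter>M\<in>Ms. (torus_map M ^^ n) -` S M)))
        \<longlonglongrightarrow> of_real (\<Prod>M\<in>Ms. measure haar_borel (S M))"
      using SN(1) by (simp add: ind integral_indicator_haar_borel INT_sets)
    then have "(\<lambda>n. measure haar_borel (\<Inter>M\<in>Ms. (torus_map M ^^ n) -` S M))
        \<longlonglongrightarrow> (\<Prod>M\<in>Ms. measure haar_borel (S M))"
      by (simp only: tendsto_of_real_iff)
    then show "(\<lambda>n. measure torus_haar (\<Inter>\<gamma>\<in>torus_map ` Ms. (\<gamma> ^^ n) -` B \<gamma>))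
        \<longlonglongrightarrow> (\<Prod>\<gamma>\<in>torus_map ` Ms. measure torus_haar (B \<gamma>))"
      by (simp add: eq eq1 prod.reindex inj_on_subset [OF inj_torus_map])
  qed
qed

section \<open>Persistent relations obstruct mixing\<close>

lemma torus_proj_cases_unit_cube:
  obtains a where "a \<in> unit_cube" "x = torus_proj a"
proof -
  obtain b where b: "x = torus_proj b" by (rule torus_proj_cases)
  have "(\<chi> i. frac (b $ i)) \<in> unit_cube" by (simp add: unit_cube_def frac_lt_1)
  moreover have "x = torus_proj (\<chi> i. frac (b $ i))"
    unfolding b by (simp add: torus_proj_eq_iff frac_def)
  ultimately show ?thesis by (rule that)
qed

lemma measure_torus_haar_open_pos:
  fixes U :: "'n::finite torus set"
  assumes "open U" "U \<noteq> {}"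
  shows "measure torus_haar U > 0"
proof -
  define V where "V = torus_proj -` U"
  have V: "open V" using assms(1) by (simp add: V_def open_torus_def)
  obtain x where "x \<in> U" using assms(2) by blast
  obtain a where a: "a \<in> unit_cube" "x = torus_proj a" by (rule torus_proj_cases_unit_cube)
  \<comment> \<open>The chosen representative may lie on the boundary of the cube. The open lift of
    \<open>U\<close> then still meets the interior, since the closed cube is the closure of the open
    box.\<close>
  have "(\<chi> i. 1 / 2) \<in> box 0 (1 :: real ^ 'n)" by (simp add: mem_box_cart)
  then have "box 0 (1 :: real ^ 'n) \<noteq> {}" by blast
  then have "closure (box 0 (1 :: real ^ 'n)) = cbox 0 1" by (rule closure_box)
  moreover have "a \<in> cbox 0 1" using a(1) by (simp add: unit_cube_def mem_box_cart less_imp_le)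
  ultimately have "V \<inter> closure (box 0 1) \<noteq> {}" using a \<open>x \<in> U\<close> by (auto simp: V_def)
  then have ne: "V \<inter> box 0 1 \<noteq> {}" using open_Int_closure_eq_empty [OF V] by blast
  have W: "open (V \<inter> box 0 1)" by (intro open_Int V open_box)
  have "emeasure lborel (V \<inter> box 0 1) \<noteq> 0"
  proof
    assume "emeasure lborel (V \<inter> box 0 1) = 0"
    then have "V \<inter> box 0 1 \<in> null_sets lborel" using W by (auto simp: null_sets_def)
    then have "negligible (V \<inter> box 0 1)"
      unfolding negligible_iff_null_sets by (rule null_sets_completionI)
    then show False using open_not_negligible [OF W ne] by blast
  qed
  moreover have "emeasure lborel (V \<inter> box 0 1) \<le> emeasure lborel (unit_cube \<inter> V)"
    using V by (intro emeasure_mono) (auto simp: unit_cube_def mem_box_cart less_imp_le)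
  ultimately have "emeasure torus_haar U \<noteq> 0"
    using assms(1) by (auto simp: emeasure_torus_haar V_def)
  moreover have "emeasure torus_haar U \<noteq> top"
    using finite_measure.emeasure_finite [OF finite_measure_haar_borel, of U] assms(1)
    by (simp add: emeasure_haar_borel)
  ultimately show ?thesis by (simp add: measure_def enn2real_positive_iff less_top zero_less_iff_neq_zero)
qed

text \<open>Along a relation, values near \<open>- 1\<close> of one character exclude values near \<open>1\<close> of all the
  others.\<close>

theorem not_mixing_set_torus_map:
  fixes Ms :: "(int ^ 'n::finite ^ 'n) set"
  assumes fin: "finite Ms" and L: "L \<in> Ms" "\<kappa> L \<noteq> 0"
    and inf: "infinite {n. (\<Sum>M\<in>Ms. ((*v) M ^^ n) (\<kappa> M)) = 0}"
  shows "\<not> mixing_set (torus_map ` Ms)"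
proof
  assume mix: "mixing_set (torus_map ` Ms)"
  \<comment> \<open>With \<open>card Ms - 1\<close> factors within \<open>d\<close> of 1 and all of
    norm 1, their product is at distance less than 1 from 1.\<close>
  define d where "d = 1 / real (card Ms)"
  define A where "A M = (if M = L then torus_char (\<kappa> M) -` ball (- 1) 1 else torus_char (\<kappa> M) -` ball 1 d)" for M
  have card: "card Ms > 0" using fin L by (auto simp: card_gt_0_iff)
  have op: "open (A M)" for M
    by (auto simp: A_def intro!: open_vimage continuous_on_torus_char)
  have "A M \<noteq> {}" for M
  proof (cases "M = L")
    case True
    obtain x where "torus_char (\<kappa> L) x = - 1" using torus_char_attains_minus_one [OF L(2)] by blast
    then have "x \<in> A M" by (simp add: A_def True)
    then show ?thesis by blast
  next
    case False
    have "torus_char (\<kappa> M) 0 * torus_char (\<kappa> M) 0 = torus_char (\<kappa> M) 0"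
      using torus_char_plus [of "\<kappa> M" 0 0] by simp
    moreover have "torus_char (\<kappa> M) 0 \<noteq> 0" using norm_torus_char [of "\<kappa> M" 0] by force
    ultimately have "torus_char (\<kappa> M) 0 = 1" by simp
    then have "0 \<in> A M" using card by (simp add: A_def False d_def)
    then show ?thesis by blast
  qed
  then have pos: "measure torus_haar (A M) > 0" for M
    using op by (intro measure_torus_haar_open_pos)
  have meas: "A M \<in> sets torus_haar" for M
    using op by (simp add: torus_haar_eq)
  define B where "B \<gamma> = A (inv torus_map \<gamma>)" for \<gamma>
  have B: "B (torus_map M) = A M" for M by (simp add: B_def inj_torus_map)
  have empty: "(\<Inter>M\<in>Ms. (torus_map M ^^ n) -` A M) = {}" if rel: "(\<Sum>M\<in>Ms. ((*v) M ^^ n) (\<kappa> M)) = 0" for n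
  proof (rule ccontr)
    assume "\<not> ?thesis"
    then obtain x where x: "\<And>M. M \<in> Ms \<Longrightarrow> (torus_map M ^^ n) x \<in> A M" by blast
    define z where "z M = torus_char (\<kappa> M) ((torus_map M ^^ n) x)" for M
    define P where "P = (\<Prod>M\<in>Ms - {L}. z M)"
    have "(\<Prod>M\<in>Ms. z M) = 1"
      by (simp add: z_def torus_char_funpow_torus_map rel flip: torus_char_sum)
    then have zP: "z L * P = 1" using fin L by (simp add: P_def prod.remove)
    have "norm (P - (\<Prod>M\<in>Ms - {L}. 1)) \<le> (\<Sum>M\<in>Ms - {L}. norm (z M - 1))"
      unfolding P_def by (rule norm_prod_diff) (simp_all add: z_def)
    also have "\<dots> \<le> (\<Sum>M\<in>Ms - {L}. d)"
    proof (rule sum_mono)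
      fix M assume "M \<in> Ms - {L}"
      then show "norm (z M - 1) \<le> d"
        using x [of M] by (simp add: A_def z_def dist_norm norm_minus_commute)
    qed
    also have "\<dots> < 1" using card fin L by (simp add: d_def field_simps)
    finally have P: "norm (P - 1) < 1" by simp
    \<comment> \<open>As \<open>z L\<close> has norm 1, it lies within distance 1 of 1. It also lies
      within distance 1 of -1, but these two points are 2 apart.\<close>
    have "1 - z L = z L * (P - 1)" using zP by (simp add: right_diff_distrib)
    then have "norm (1 - z L) < 1" using P by (simp add: norm_mult z_def)
    moreover have "dist (z L) (- 1) < 1"
      using x [OF L(1)] by (simp add: A_def z_def dist_commute)
    then have "norm (z L + 1) < 1" by (simp add: dist_norm)
    ultimately have "norm ((1 - z L) + (z L + 1)) < 1 + 1" by (rule norm_add_less)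
    then show False by simp
  qed
  have "\<forall>\<gamma>\<in>torus_map ` Ms. B \<gamma> \<in> sets torus_haar" by (simp add: B_def meas)
  then have "(\<lambda>n. measure torus_haar (\<Inter>\<gamma>\<in>torus_map ` Ms. (\<gamma> ^^ n) -` B \<gamma>))
      \<longlonglongrightarrow> (\<Prod>\<gamma>\<in>torus_map ` Ms. measure torus_haar (B \<gamma>))"
    using mix unfolding mixing_set_def by blast
  then have "(\<lambda>n. measure torus_haar (\<Inter>M\<in>Ms. (torus_map M ^^ n) -` A M))
      \<longlonglongrightarrow> (\<Prod>M\<in>Ms. measure torus_haar (A M))"
    by (simp add: B prod.reindex inj_on_subset [OF inj_torus_map])
  \<comment> \<open>A positive limit makes the measures positive eventually, against the empty
    intersections at infinitely many n.\<close>
  moreover have "(\<Prod>M\<in>Ms. measure torus_haar (A M)) > 0" by (intro prod_pos pos)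
  ultimately have "\<forall>\<^sub>F n in sequentially. measure torus_haar (\<Inter>M\<in>Ms. (torus_map M ^^ n) -` A M) > 0"
    by (rule order_tendstoD(1))
  then obtain N where N: "\<And>n. n \<ge> N \<Longrightarrow> measure torus_haar (\<Inter>M\<in>Ms. (torus_map M ^^ n) -` A M) > 0"
    by (auto simp: eventually_sequentially)
  obtain n where "n \<ge> N" "(\<Sum>M\<in>Ms. ((*v) M ^^ n) (\<kappa> M)) = 0"
    using inf by (auto simp: infinite_nat_iff_unbounded_le)
  then show False using N [of n] empty [of n] by simp
qed

section \<open>Doubling\<close>

lemma funpow_double_matrix: "((*v) (double_matrix M) ^^ n) k = 2 ^ n *s ((*v) M ^^ n) k"
  for M :: "int ^ 'n::finite ^ 'n"
proof (induction n)
  case (Suc n)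
  have "M *v (c *s v) = c *s (M *v v)" for c v
    by (simp add: vec_eq_iff matrix_vector_mult_def sum_distrib_left mult_ac)
  with Suc show ?case by (simp add: double_matrix_mult_vec vector_smult_assoc)
qed simp

lemma inj_double_matrix: "inj double_matrix"
  by (rule injI) (simp add: double_matrix_def vec_eq_iff)

text \<open>The common factor \<open>2 ^ n\<close> of all terms cancels, since integer vectors have
  no torsion.\<close>

lemma sum_double_matrix_eq_0_iff:
  fixes Ms :: "(int ^ 'n::finite ^ 'n) set"
  shows "(\<Sum>M\<in>double_matrix ` Ms. ((*v) M ^^ n) (\<kappa> M)) = 0
    \<longleftrightarrow> (\<Sum>M\<in>Ms. ((*v) M ^^ n) (\<kappa> (double_matrix M))) = 0"
proof -
  have "(\<Sum>M\<in>double_matrix ` Ms. ((*v) M ^^ n) (\<kappa> M))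
      = 2 ^ n *s (\<Sum>M\<in>Ms. ((*v) M ^^ n) (\<kappa> (double_matrix M)))"
    by (simp add: sum.reindex inj_on_subset [OF inj_double_matrix] funpow_double_matrix
        vec_eq_iff sum_distrib_left)
  then show ?thesis by (simp add: vec_eq_iff)
qed

text \<open>Mixing of a single T is the set condition for the pair of \<open>id\<close> and T. A
  relation at infinitely many n makes \<open>\<kappa> (mat 1)\<close> divisible by arbitrarily high
  powers of 2, hence 0; invertibility of \<open>M\<close> then kills the other vector.\<close>

lemma mixing_epi_double_matrix:
  fixes M N :: "int ^ 'n::finite ^ 'n"
  assumes MN: "M ** N = mat 1" "N ** M = mat 1"
  shows "mixing_epi (torus_map (double_matrix M))"
proof -
  let ?D = "double_matrix M"
  have "?D $ i $ i \<noteq> mat 1 $ i $ i" for i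
    by (simp add: double_matrix_def mat_def) presburger
  then have D: "?D \<noteq> mat 1" by metis
  have inj: "((*v) M ^^ n) k = 0 \<longleftrightarrow> k = 0" for n k
    by (rule funpow_mult_vec_eq_0_iff [OF MN(2)])
  have "mixing_set (torus_map ` {mat 1, ?D})"
  proof (rule mixing_set_torus_mapI)
    fix \<kappa> :: "int ^ 'n ^ 'n \<Rightarrow> int ^ 'n"
    assume nz: "\<exists>L\<in>{mat 1, ?D}. \<kappa> L \<noteq> 0"
    have sum: "(\<Sum>L\<in>{mat 1, ?D}. ((*v) L ^^ n) (\<kappa> L)) = \<kappa> (mat 1) + 2 ^ n *s ((*v) M ^^ n) (\<kappa> ?D)" for n
      using D by (simp add: funpow_double_matrix funpow_mult_vec_fixed)
    show "finite {n. (\<Sum>L\<in>{mat 1, ?D}. ((*v) L ^^ n) (\<kappa> L)) = 0}"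
    proof (rule ccontr)
      assume "infinite {n. (\<Sum>L\<in>{mat 1, ?D}. ((*v) L ^^ n) (\<kappa> L)) = 0}"
      then have inf: "\<exists>n\<ge>m. \<kappa> (mat 1) + 2 ^ n *s ((*v) M ^^ n) (\<kappa> ?D) = 0" for m
        by (simp add: sum infinite_nat_iff_unbounded_le)
      have "\<kappa> (mat 1) $ i = 0" for i
      proof -
        \<comment> \<open>Such an n satisfies
          \<open>2 ^ n > \<bar>\<kappa> (mat 1) $ i\<bar>\<close>, so divisibility by
          \<open>2 ^ n\<close> leaves only 0.\<close>
        obtain n where n: "n \<ge> nat \<bar>\<kappa> (mat 1) $ i\<bar>" "\<kappa> (mat 1) + 2 ^ n *s ((*v) M ^^ n) (\<kappa> ?D) = 0"
          using inf by blast
        have "(\<kappa> (mat 1) + 2 ^ n *s ((*v) M ^^ n) (\<kappa> ?D)) $ i = 0" using n(2) by (simp only: zero_index)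
        then have "\<kappa> (mat 1) $ i = 2 ^ n * - (((*v) M ^^ n) (\<kappa> ?D) $ i)" by simp
        then have dvd: "2 ^ n dvd \<kappa> (mat 1) $ i" by (rule dvdI)
        have "\<bar>\<kappa> (mat 1) $ i\<bar> \<le> int n" using n(1) by simp
        also have "int n < 2 ^ n" by (metis of_nat_less_two_power)
        finally show ?thesis using dvd zdvd_imp_le [of "2 ^ n" "\<bar>\<kappa> (mat 1) $ i\<bar>"] by force
      qed
      then have 1: "\<kappa> (mat 1) = 0" by (simp add: vec_eq_iff)
      obtain n where "2 ^ n *s ((*v) M ^^ n) (\<kappa> ?D) = 0" using inf [of 0] by (auto simp: 1)
      then have "((*v) M ^^ n) (\<kappa> ?D) = 0" by (simp add: vec_eq_iff)
      then have "\<kappa> ?D = 0" by (simp add: inj)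
      with 1 nz show False by simp
    qed
  qed simp
  then have mix: "mixing_set {id, torus_map ?D}" by simp
  have ne: "torus_map ?D \<noteq> id"
    using D inj_torus_map by (metis injD torus_map_one)
  show ?thesis
    unfolding mixing_epi_def
  proof (intro conjI ballI)
    show "torus_epi (torus_map ?D)" by (rule torus_epi_torus_map_double [OF MN])
    fix A B :: "'n torus set"
    assume AB: "A \<in> sets torus_haar" "B \<in> sets torus_haar"
    define C where "C \<gamma> = (if \<gamma> = id then A else B)" for \<gamma> :: "'n torus \<Rightarrow> 'n torus"
    have "\<forall>\<gamma>\<in>{id, torus_map ?D}. C \<gamma> \<in> sets torus_haar" using AB by (simp add: C_def)
    then have "(\<lambda>n. measure torus_haar (\<Inter>\<gamma>\<in>{id, torus_map ?D}. (\<gamma> ^^ n) -` C \<gamma>))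
        \<longlonglongrightarrow> (\<Prod>\<gamma>\<in>{id, torus_map ?D}. measure torus_haar (C \<gamma>))"
      using mix unfolding mixing_set_def by blast
    then show "(\<lambda>n. measure torus_haar (A \<inter> (torus_map ?D ^^ n) -` B))
        \<longlonglongrightarrow> measure torus_haar A * measure torus_haar B"
      using ne by (simp add: C_def)
  qed
qed

section \<open>Minimal non-mixing sets\<close>

lemma infinite_relation_double_matrix:
  fixes Ms :: "(int ^ 'n::finite ^ 'n) set"
  assumes "infinite {n. (\<Sum>M\<in>Ms. ((*v) M ^^ n) (\<kappa> M)) = 0}"
  shows "infinite {n. (\<Sum>M\<in>double_matrix ` Ms. ((*v) M ^^ n) (\<kappa> (inv double_matrix M))) = 0}"
  using assms by (simp add: sum_double_matrix_eq_0_iff inj_double_matrix)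

text \<open>Settles the requirement on proper subsets for s = 2.\<close>

lemma finite_psubset_card_two:
  assumes "card F = 2" "G \<subset> F"
  shows "\<not> card G > 1"
  using assms psubset_card_mono [of F G] card_ge_0_finite [of F] by simp

lemma minimal_nonmixing_torus_map:
  fixes Ms :: "(int ^ 'n::finite ^ 'n) set"
  assumes "finite Ms" "L \<in> Ms" "\<kappa> L \<noteq> 0"
    and "infinite {n. (\<Sum>M\<in>Ms. ((*v) M ^^ n) (\<kappa> M)) = 0}"
    and sub: "\<And>Ns \<mu>. Ns \<subset> Ms \<Longrightarrow> card Ns > 1 \<Longrightarrow> \<exists>M\<in>Ns. \<mu> M \<noteq> 0
        \<Longrightarrow> finite {n. (\<Sum>M\<in>Ns. ((*v) M ^^ n) (\<mu> M)) = 0}"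
  shows "card (torus_map ` Ms) = card Ms \<and> \<not> mixing_set (torus_map ` Ms)
    \<and> (\<forall>G. G \<subset> torus_map ` Ms \<and> card G > 1 \<longrightarrow> mixing_set G)"
proof (intro conjI allI impI)
  show "card (torus_map ` Ms) = card Ms"
    by (intro card_image inj_on_subset [OF inj_torus_map]) simp
  show "\<not> mixing_set (torus_map ` Ms)" by (rule not_mixing_set_torus_map) fact+
  fix G assume G: "G \<subset> torus_map ` Ms \<and> card G > 1"
  then obtain Ns where Ns: "Ns \<subseteq> Ms" "G = torus_map ` Ns" by (meson psubsetE subset_image_iff)
  then have "Ns \<subset> Ms" using G by blast
  moreover have "card Ns > 1"
    using G Ns(2) card_image [OF inj_on_subset [OF inj_torus_map], of Ns] by simp
  ultimately show "mixing_set G"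
    unfolding Ns(2) using finite_subset [OF Ns(1) assms(1)] sub by (intro mixing_set_torus_mapI)
qed

lemma unipotent_auto_torus_map:
  assumes "unipotent_matrix M"
  shows "unipotent_auto (torus_map M)"
proof -
  obtain N where "M ** N = mat 1" "N ** M = mat 1" using unipotent_matrix_invertible [OF assms] .
  then show ?thesis
    using assms dual_matrix_torus_map torus_auto_torus_map by (auto simp: unipotent_auto_def)
qed

text \<open>The common source of both parts for s >= 3. The dependent vectors are fixed, so their
  relation holds at every n.\<close>

lemma ex_minimal_nonmixing_matrices:
  assumes "3 \<le> s" "s \<le> CARD('n::finite) + 1"
  obtains Ms :: "(int ^ 'n ^ 'n) set" and L \<kappa> where
    "finite Ms" "card Ms = s" "\<And>M. M \<in> Ms \<Longrightarrow> unipotent_matrix M" "L \<in> Ms" "\<kappa> L \<noteq> 0"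
    "infinite {n. (\<Sum>M\<in>Ms. ((*v) M ^^ n) (\<kappa> M)) = 0}"
    "\<And>Ns \<mu>. Ns \<subset> Ms \<Longrightarrow> \<exists>M\<in>Ns. \<mu> M \<noteq> 0 \<Longrightarrow> finite {n. (\<Sum>M\<in>Ns. ((*v) M ^^ n) (\<mu> M)) = 0}"
proof -
  obtain Ms :: "(int ^ 'n ^ 'n) set" and \<kappa> where Ms: "finite Ms" "card Ms = s"
    and unip: "\<And>M. M \<in> Ms \<Longrightarrow> unipotent_matrix M"
    and fixed: "\<And>M. M \<in> Ms \<Longrightarrow> M *v \<kappa> M = \<kappa> M" and nz: "\<And>M. M \<in> Ms \<Longrightarrow> \<kappa> M \<noteq> 0"
    and sum0: "(\<Sum>M\<in>Ms. \<kappa> M) = 0"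
    and indep: "\<And>\<mu> Ns. Ns \<subset> Ms \<Longrightarrow> \<forall>M\<in>Ns. M *v \<mu> M = \<mu> M \<Longrightarrow> (\<Sum>M\<in>Ns. \<mu> M) = 0
       \<Longrightarrow> \<forall>M\<in>Ns. \<mu> M = 0"
    by (rule ex_minimally_dependent_unipotents [OF assms]) (rule that)
  have "Ms \<noteq> {}" using Ms(2) assms by auto
  then obtain L where L: "L \<in> Ms" by blast
  have "(\<Sum>M\<in>Ms. ((*v) M ^^ n) (\<kappa> M)) = 0" for n
    using sum0 fixed by (simp add: funpow_mult_vec_fixed)
  then have inf: "infinite {n. (\<Sum>M\<in>Ms. ((*v) M ^^ n) (\<kappa> M)) = 0}" by simp
  have rel: "finite {n. (\<Sum>M\<in>Ns. ((*v) M ^^ n) (\<mu> M)) = 0}" if Ns: "Ns \<subset> Ms" and "\<exists>M\<in>Ns. \<mu> M \<noteq> 0" for Ns \<mu>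
  proof (rule unipotent_relation_finite)
    show "finite Ns" using Ns Ms(1) finite_subset by blast
    show "unipotent_matrix M" if "M \<in> Ns" for M using that Ns unip by blast
    show "\<forall>M\<in>Ns. \<nu> M = 0" if "\<And>M. M \<in> Ns \<Longrightarrow> M *v \<nu> M = \<nu> M" "(\<Sum>M\<in>Ns. \<nu> M) = 0" for \<nu>
      using indep [OF Ns] that by blast
  qed fact
  show ?thesis by (rule that [OF Ms unip L nz [OF L] inf rel])
qed

lemma ex_minimal_nonmixing_unipotent:
  assumes "CARD('n::finite) \<ge> 2" "s \<in> {2..CARD('n) + 1}"
  shows "\<exists>F :: ('n torus \<Rightarrow> 'n torus) set. card F = s \<and> (\<forall>T\<in>F. unipotent_auto T) \<and>
    \<not> mixing_set F \<and> (\<forall>G. G \<subset> F \<and> card G > 1 \<longrightarrow> mixing_set G)"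
proof (cases "s = 2")
  case True
  \<comment> \<open>A second coordinate supplies a vector off the fixed line of \<open>U\<close>, so
    that \<open>U\<close> is not the identity.\<close>
  obtain i j :: 'n where ij: "i \<noteq> j"
    using assms(1) card_2_iff' [of "UNIV :: 'n set"] by (metis UNIV_I ex_card card_2_iff)
  obtain U :: "int ^ 'n ^ 'n" where U: "unipotent_matrix U" "U *v axis j 1 = axis j 1"
    "\<And>k. U *v k = k \<Longrightarrow> \<exists>c. k = c *s axis j 1"
    using ex_jordan_block by blast
  have "U \<noteq> mat 1"
  proof
    assume "U = mat 1"
    then obtain c where "axis i 1 = c *s (axis j 1 :: int ^ 'n)" using U(3) [of "axis i 1"] by auto
    then have "axis i 1 $ i = (c *s (axis j 1 :: int ^ 'n)) $ i" by simp
    then show False using ij by (simp add: axis_def)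
  qed
  then have card: "card {mat 1, U} = 2" by simp
  \<comment> \<open>Both matrices fix \<open>axis j 1\<close>, so opposite signs cancel at every
    n.\<close>
  define \<kappa> :: "int ^ 'n ^ 'n \<Rightarrow> int ^ 'n" where "\<kappa> M = (if M = U then axis j 1 else - axis j 1)" for M
  have "(\<Sum>M\<in>{mat 1, U}. ((*v) M ^^ n) (\<kappa> M)) = 0" for n
    using \<open>U \<noteq> mat 1\<close> by (simp add: \<kappa>_def funpow_mult_vec_fixed U(2))
  then have inf: "infinite {n. (\<Sum>M\<in>{mat 1, U}. ((*v) M ^^ n) (\<kappa> M)) = 0}" by simp
  have "((**) (mat 1 - mat 1) ^^ 1) (mat 1) = (0 :: int ^ 'n ^ 'n)" by simp
  then have "unipotent_matrix (mat 1 :: int ^ 'n ^ 'n)" unfolding unipotent_matrix_def by blast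
  then have unip: "\<forall>T\<in>torus_map ` {mat 1, U}. unipotent_auto T"
    using U(1) unipotent_auto_torus_map by blast
  have "\<kappa> U \<noteq> 0" by (simp add: \<kappa>_def axis_eq_0_iff)
  have "card (torus_map ` {mat 1, U}) = card {mat 1, U} \<and> \<not> mixing_set (torus_map ` {mat 1, U})
    \<and> (\<forall>G. G \<subset> torus_map ` {mat 1, U} \<and> card G > 1 \<longrightarrow> mixing_set G)"
    by (rule minimal_nonmixing_torus_map [OF _ _ \<open>\<kappa> U \<noteq> 0\<close> inf])
       (use finite_psubset_card_two [OF card] in \<open>simp, simp, blast\<close>)
  with card unip True show ?thesis by (intro exI [of _ "torus_map ` {mat 1, U}"]) (simp only: simp_thms, blast)
next
  case False
  then have "3 \<le> s" "s \<le> CARD('n) + 1" using assms by auto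
  then obtain Ms :: "(int ^ 'n ^ 'n) set" and L \<kappa> where Ms: "finite Ms" "card Ms = s"
    "\<And>M. M \<in> Ms \<Longrightarrow> unipotent_matrix M" "L \<in> Ms" "\<kappa> L \<noteq> 0"
    "infinite {n. (\<Sum>M\<in>Ms. ((*v) M ^^ n) (\<kappa> M)) = 0}"
    "\<And>Ns \<mu>. Ns \<subset> Ms \<Longrightarrow> \<exists>M\<in>Ns. \<mu> M \<noteq> 0 \<Longrightarrow> finite {n. (\<Sum>M\<in>Ns. ((*v) M ^^ n) (\<mu> M)) = 0}"
    by (rule ex_minimal_nonmixing_matrices) (rule that)
  have "card (torus_map ` Ms) = card Ms \<and> \<not> mixing_set (torus_map ` Ms)
    \<and> (\<forall>G. G \<subset> torus_map ` Ms \<and> card G > 1 \<longrightarrow> mixing_set G)"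
    by (rule minimal_nonmixing_torus_map [OF Ms(1,4,5,6) Ms(7)])
  moreover have "\<forall>T\<in>torus_map ` Ms. unipotent_auto T" using Ms(3) unipotent_auto_torus_map by blast
  ultimately show ?thesis
    using Ms(2) by (intro exI [of _ "torus_map ` Ms"]) (simp only: simp_thms, blast)
qed

lemma ex_minimal_nonmixing_mixing_epi:
  assumes "s \<in> {2..CARD('n::finite) + 1}"
  shows "\<exists>F :: ('n torus \<Rightarrow> 'n torus) set. card F = s \<and> (\<forall>T\<in>F. mixing_epi T) \<and>
    \<not> mixing_set F \<and> (\<forall>G. G \<subset> F \<and> card G > 1 \<longrightarrow> mixing_set G)"
proof -
  \<comment> \<open>Only invertibility and the relations enter, so this covers the unipotent
    matrices for s >= 3 as well as the pair 1, -1.\<close>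
  have double: "\<exists>F :: ('n torus \<Rightarrow> 'n torus) set. card F = s \<and> (\<forall>T\<in>F. mixing_epi T) \<and>
      \<not> mixing_set F \<and> (\<forall>G. G \<subset> F \<and> card G > 1 \<longrightarrow> mixing_set G)"
    if Ms: "finite Ms" "card Ms = s" and L: "L \<in> Ms" "\<kappa> L \<noteq> 0"
      and inf: "infinite {n. (\<Sum>M\<in>Ms. ((*v) M ^^ n) (\<kappa> M)) = 0}"
      and inv: "\<And>M. M \<in> Ms \<Longrightarrow> \<exists>N. M ** N = mat 1 \<and> N ** M = mat 1"
      and rel: "\<And>Ns \<mu>. Ns \<subset> Ms \<Longrightarrow> card Ns > 1 \<Longrightarrow> \<exists>M\<in>Ns. \<mu> M \<noteq> 0
        \<Longrightarrow> finite {n. (\<Sum>M\<in>Ns. ((*v) M ^^ n) (\<mu> M)) = 0}"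
    for Ms :: "(int ^ 'n ^ 'n) set" and L and \<kappa> :: "int ^ 'n ^ 'n \<Rightarrow> int ^ 'n"
  proof (intro exI conjI)
    let ?D = "double_matrix ` Ms"
    have card_D: "card (double_matrix ` Ns) = card Ns" for Ns :: "(int ^ 'n ^ 'n) set"
      by (intro card_image inj_on_subset [OF inj_double_matrix]) simp
    have *: "card (torus_map ` ?D) = card ?D \<and> \<not> mixing_set (torus_map ` ?D)
      \<and> (\<forall>G. G \<subset> torus_map ` ?D \<and> card G > 1 \<longrightarrow> mixing_set G)"
    proof (rule minimal_nonmixing_torus_map)
      show "finite ?D" "double_matrix L \<in> ?D" using Ms(1) L(1) by auto
      show "\<kappa> (inv double_matrix (double_matrix L)) \<noteq> 0" using L(2) by (simp add: inj_double_matrix)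
      show "infinite {n. (\<Sum>M\<in>?D. ((*v) M ^^ n) (\<kappa> (inv double_matrix M))) = 0}"
        by (rule infinite_relation_double_matrix [OF inf])
      fix Es :: "(int ^ 'n ^ 'n) set" and \<mu> :: "int ^ 'n ^ 'n \<Rightarrow> int ^ 'n"
      assume Es: "Es \<subset> ?D" "card Es > 1" "\<exists>M\<in>Es. \<mu> M \<noteq> 0"
      then obtain Ns where Ns: "Ns \<subseteq> Ms" "Es = double_matrix ` Ns" by (meson psubsetE subset_image_iff)
      have "finite {n. (\<Sum>M\<in>Ns. ((*v) M ^^ n) (\<mu> (double_matrix M))) = 0}"
      proof (rule rel)
        show "Ns \<subset> Ms" "card Ns > 1" "\<exists>M\<in>Ns. \<mu> (double_matrix M) \<noteq> 0"
          using Es Ns card_D by auto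
      qed
      then show "finite {n. (\<Sum>M\<in>Es. ((*v) M ^^ n) (\<mu> M)) = 0}"
        unfolding Ns(2) sum_double_matrix_eq_0_iff .
    qed
    then show "\<not> mixing_set (torus_map ` ?D)"
      "\<forall>G. G \<subset> torus_map ` ?D \<and> card G > 1 \<longrightarrow> mixing_set G" by blast+
    show "card (torus_map ` ?D) = s" using * card_D [of Ms] Ms(2) by simp
    show "\<forall>T\<in>torus_map ` ?D. mixing_epi T"
      using inv mixing_epi_double_matrix by blast
  qed
  show ?thesis
  proof (cases "s = 2")
    case True
    \<comment> \<open>Doubling the pair \<open>mat 1\<close>, \<open>U\<close> would need a
      nontrivial unipotent matrix, hence dimension at least 2; the negative of the identity also
      serves the circle.\<close>
    let ?J = "- mat 1 :: int ^ 'n ^ 'n"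
    define i :: 'n where "i = undefined"
    have "mat 1 $ i $ i \<noteq> ?J $ i $ i" by (simp add: mat_def)
    then have "mat 1 \<noteq> ?J" by metis
    then have card: "card {mat 1, ?J} = 2" by simp
    have J: "?J *v k = - k" for k
      by (simp add: vec_eq_iff matrix_vector_mult_def mat_def sum_negf if_distrib if_distribR cong: if_cong)
    have JJ: "?J ** ?J = mat 1"
      by (simp add: matrix_eq J flip: matrix_vector_mul_assoc)
    have iter: "((*v) ?J ^^ n) k = (if even n then k else - k)" for n k
      by (induction n) (simp_all add: J)
    define \<kappa> :: "int ^ 'n ^ 'n \<Rightarrow> int ^ 'n" where "\<kappa> M = (if M = mat 1 then axis i 1 else - axis i 1)" for M
    \<comment> \<open>The relation holds at even n only, which is infinitely often and therefore
      enough.\<close>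
    have "(\<Sum>M\<in>{mat 1, ?J}. ((*v) M ^^ n) (\<kappa> M)) = 0" if "even n" for n
      using \<open>mat 1 \<noteq> ?J\<close> that by (simp add: \<kappa>_def iter funpow_mult_vec_fixed)
    then have "{n. even n} \<subseteq> {n. (\<Sum>M\<in>{mat 1, ?J}. ((*v) M ^^ n) (\<kappa> M)) = 0}" by blast
    moreover have "infinite {n :: nat. even n}"
      unfolding infinite_nat_iff_unbounded_le
    proof
      fix m :: nat
      show "\<exists>n\<ge>m. n \<in> {n. even n}" by (rule exI [of _ "2 * m"]) simp
    qed
    ultimately have inf: "infinite {n. (\<Sum>M\<in>{mat 1, ?J}. ((*v) M ^^ n) (\<kappa> M)) = 0}"
      using finite_subset by blast
    have "\<exists>N. M ** N = mat 1 \<and> N ** M = mat 1" if "M \<in> {mat 1, ?J}" for M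
      using that JJ by (auto intro: exI [of _ "mat 1"] exI [of _ ?J])
    moreover have "\<kappa> (mat 1) \<noteq> 0" by (simp add: \<kappa>_def axis_eq_0_iff)
    ultimately show ?thesis
      using finite_psubset_card_two [OF card] card True
      by (intro double [OF _ _ _ _ inf, of "mat 1"]) auto
  next
    case False
    then have "3 \<le> s" "s \<le> CARD('n) + 1" using assms by auto
    then obtain Ms :: "(int ^ 'n ^ 'n) set" and L \<kappa> where Ms: "finite Ms" "card Ms = s"
      and unip: "\<And>M. M \<in> Ms \<Longrightarrow> unipotent_matrix M"
      and L: "L \<in> Ms" "\<kappa> L \<noteq> 0" "infinite {n. (\<Sum>M\<in>Ms. ((*v) M ^^ n) (\<kappa> M)) = 0}"
      and rel: "\<And>Ns \<mu>. Ns \<subset> Ms \<Longrightarrow> \<exists>M\<in>Ns. \<mu> M \<noteq> 0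
        \<Longrightarrow> finite {n. (\<Sum>M\<in>Ns. ((*v) M ^^ n) (\<mu> M)) = 0}"
      by (rule ex_minimal_nonmixing_matrices) (rule that)
    have "\<exists>N. M ** N = mat 1 \<and> N ** M = mat 1" if "M \<in> Ms" for M
      using unipotent_matrix_invertible [OF unip [OF that]] by blast
    then show ?thesis by (rule double [OF Ms L]) (assumption, rule rel)
  qed
qed

theorem corollary1p11:
  shows
    "(CARD('n::finite) \<ge> 2 \<longrightarrow>
       (\<forall>s\<in>{2..CARD('n) + 1}.
          \<exists>F :: ('n torus \<Rightarrow> 'n torus) set.
            card F = s \<and> (\<forall>T\<in>F. unipotent_auto T) \<and>
            \<not> mixing_set F \<and> (\<forall>G. G \<subset> F \<and> card G > 1 \<longrightarrow> mixing_set G)))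
     \<and>
     (\<forall>s\<in>{2..CARD('n) + 1}.
        \<exists>F :: ('n torus \<Rightarrow> 'n torus) set.
          card F = s \<and> (\<forall>T\<in>F. mixing_epi T) \<and>
          \<not> mixing_set F \<and> (\<forall>G. G \<subset> F \<and> card G > 1 \<longrightarrow> mixing_set G))"
  by (intro conjI impI ballI ex_minimal_nonmixing_unipotent ex_minimal_nonmixing_mixing_epi)

end
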